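(* Let $\mathcal{H}_1\to\mathcal{H}_2$ be a central morphism of affine Hecke algebras and let $V$ be an $\mathcal{H}_2$-module. Then $\mathrm{Res}^{\mathcal{H}_2}_{\mathcal{H}_1}(V^\dagger)=(\mathrm{Res}^{\mathcal{H}_2}_{\mathcal{H}_1}V)^\dagger$. If $V$ is unitary then so is $\mathrm{Res}^{\mathcal{H}_2}_{\mathcal{H}_1}V$. If $V$ is unitary and finite-dimensional then $\mathrm{Res}^{\mathcal{H}_2}_{\mathcal{H}_1}V$ is a direct sum of simple unitary modules.
   Context: Affine Hecke algebras. Let $\mathcal{R} = (X,R,Y,R^\vee,\Delta)$ be a reduced based root datum ($X,Y$ free abelian of finite rank in perfect duality $\langle\cdot,\cdot\rangle$, $\Delta\subset R$ a base of simple roots), with finite Weyl group $W$, longest element $w_0\in W$ and simple reflections $s_\alpha$, $\alpha\in\Delta$. Fix $q\in\mathbb{R}_{>1}$ and parameter functions $\lambda,\lambda^*: R\to\mathbb{R}\setminus\{0\}$, constant on orbits of $W\ltimes X$ (acting on $R$ through $W$), with $\lambda(\alpha)=\lambda^*(\alpha)$ if $\alpha^\vee\notin 2Y$ and $\lambda(\alpha)+\lambda^*(\alpha)\neq 0$ if $\alpha^\vee\in 2Y$. The affine Hecke algebra $\mathcal{H}=\mathcal{H}(\mathcal{R})$ is the $\mathbb{C}$-algebra with linear basis $\theta_xT_w$ ($x\in X$, $w\in W$) and relations: $T_wT_{w'}=T_{ww'}$ if $\ell(ww')=\ell(w)+\ell(w')$; $(T_{s_\alpha}+1)(T_{s_\alpha}-q^{\lambda(\alpha)})=0$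 for $\alpha\in\Delta$; $\theta_x\theta_y=\theta_{x+y}$; and, for $s=s_\alpha$, $\alpha\in\Delta$, $T_s\theta_x=\theta_{s(x)}T_s+(q^{\lambda(\alpha)}-1)\frac{\theta_x-\theta_{s(x)}}{1-\theta_{-\alpha}}$ if $\alpha^\vee\notin 2Y$, and $T_s\theta_x=\theta_{s(x)}T_s+\big((q^{\lambda(\alpha)}-1)+\theta_{-\alpha}(q^{(\lambda(\alpha)+\lambda^*(\alpha))/2}-q^{(\lambda(\alpha)-\lambda^*(\alpha))/2})\big)\frac{\theta_x-\theta_{s(x)}}{1-\theta_{-2\alpha}}$ if $\alpha^\vee\in 2Y$. Star operation. $*:\mathcal{H}\to\mathcal{H}$ is the conjugate-linear anti-automorphism with $T_w^*=T_{w^{-1}}$ ($w\in W$) and $\theta_x^*=T_{w_0}\theta_{-w_0(x)}T_{w_0}^{-1}$ ($x\in X$). For an $\mathcal{H}$-module $V$, the hermitian dual is $V^\dagger=\mathrm{Hom}_{\mathbb{C}}(\overline V,\mathbb{C})$ (conjugate-linear functionals on $V$) with action $(h\mu)(v)=\mu(h^*v)$. A hermitian form on $V$ is $*$-invariant if $\langle hv,v'\rangle=\langle v,h^*v'\rangle$; $V$ is unitary if it admits a positive definite $*$-invariant hermitian form. Central morphisms. A central morphism of based root data $(X_1,R_1,Y_1,R_1^\vee,\Delta_1)\to(X_2,R_2,Y_2,R_2^\vee,\Delta_2)$ is a group homomorphism $f:X_1\to X_2$ that restricts to an isomorphism of based root systems $(\mathbb{R}R_1,R_1,\mathbb{R}R_1^\vee,R_1^\vee,\Delta_1)\to(\mathbb{R}R_2,R_2,\mathbb{R}R_2^\vee,R_2^\vee,\Delta_2)$,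 where the transpose $f^\vee:Y_2\to Y_1$ sends $f(\alpha)^\vee$ to $\alpha^\vee$ for all $\alpha\in R_1$ (so the Weyl groups are identified and $f$ is $W$-equivariant). If the parameters are compatible (same $q$, $\lambda_2\circ f=\lambda_1$ and $\lambda_2^*\circ f=\lambda_1^*$ on $R_1$), there is an algebra homomorphism $\mathcal{H}_1=\mathcal{H}(\mathcal{R}_1)\to\mathcal{H}_2=\mathcal{H}(\mathcal{R}_2)$, $\theta_xT_w\mapsto\theta_{f(x)}T_w$, called a central morphism of affine Hecke algebras. $\mathrm{Res}^{\mathcal{H}_2}_{\mathcal{H}_1}$ is restriction along it. *)

theory Defs
  imports Complex_Main "HOL-Library.FuncSet" "HOL-Library.Function_Algebras"
begin

section \<open>Based root data\<close>

definition zscale :: "int \<Rightarrow> 'a::ab_group_add \<Rightarrow> 'a" where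
  "zscale n x = (if 0 \<le> n then (\<Sum>i<nat n. x) else - (\<Sum>i<nat (- n). x))"

definition free_finite_rank :: "'a::ab_group_add itself \<Rightarrow> bool" where
  "free_finite_rank _ \<longleftrightarrow>
     (\<exists>B::'a set. finite B \<and> \<not> module.dependent zscale B \<and> module.span zscale B = UNIV)"

text \<open>The lattices \<open>X\<close> and \<open>Y\<close> are the full types \<open>'x\<close> and \<open>'y\<close>.  The set \<open>R\<^sup>\<or>\<close> is the image of
  \<^term>\<open>roots\<close> under \<^term>\<open>coroot\<close>; values of \<^term>\<open>coroot\<close> outside the roots are irrelevant.\<close>

record ('x, 'y) root_datum =
  pairing :: "'x \<Rightarrow> 'y \<Rightarrow> int"
  roots :: "'x set"
  coroot :: "'x \<Rightarrow> 'y"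
  simple_roots :: "'x set"

definition reflection :: "('x::ab_group_add, 'y) root_datum \<Rightarrow> 'x \<Rightarrow> 'x \<Rightarrow> 'x" where
  "reflection D \<alpha> x = x - zscale (pairing D x (coroot D \<alpha>)) \<alpha>"

definition coreflection :: "('x, 'y::ab_group_add) root_datum \<Rightarrow> 'x \<Rightarrow> 'y \<Rightarrow> 'y" where
  "coreflection D \<alpha> y = y - zscale (pairing D \<alpha> y) (coroot D \<alpha>)"

definition perfect_pairing :: "('x::ab_group_add \<Rightarrow> 'y::ab_group_add \<Rightarrow> int) \<Rightarrow> bool" where
  "perfect_pairing p \<longleftrightarrow>
     (\<forall>y. additive (\<lambda>x. p x y)) \<and> (\<forall>x. additive (\<lambda>y. p x y)) \<and>
     (\<forall>g. additive g \<longrightarrow> (\<exists>!y. \<forall>x. p x y = g x)) \<and>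
     (\<forall>g. additive g \<longrightarrow> (\<exists>!x. \<forall>y. p x y = g y))"

definition is_base :: "'x::ab_group_add set \<Rightarrow> 'x set \<Rightarrow> bool" where
  "is_base R \<Delta> \<longleftrightarrow> \<Delta> \<subseteq> R \<and> \<not> module.dependent zscale \<Delta> \<and>
     (\<forall>\<alpha>\<in>R. \<exists>c::'x \<Rightarrow> nat.
        \<alpha> = (\<Sum>\<delta>\<in>\<Delta>. zscale (int (c \<delta>)) \<delta>) \<or> \<alpha> = - (\<Sum>\<delta>\<in>\<Delta>. zscale (int (c \<delta>)) \<delta>))"

text \<open>\<open>\<rat>\<alpha> \<inter> R = {\<alpha>, -\<alpha>}\<close>, with denominators cleared.\<close>

definition reduced_roots :: "'x::ab_group_add set \<Rightarrow> bool" where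
  "reduced_roots R \<longleftrightarrow>
     (\<forall>\<alpha>\<in>R. \<forall>\<beta>\<in>R. \<forall>m n::int. m \<noteq> 0 \<and> n \<noteq> 0 \<and> zscale m \<alpha> = zscale n \<beta> \<longrightarrow> \<beta> = \<alpha> \<or> \<beta> = - \<alpha>)"

definition reduced_based_root_datum ::
    "('x::ab_group_add, 'y::ab_group_add) root_datum \<Rightarrow> bool" where
  "reduced_based_root_datum D \<longleftrightarrow>
     free_finite_rank TYPE('x) \<and> free_finite_rank TYPE('y) \<and> perfect_pairing (pairing D) \<and>
     finite (roots D) \<and> inj_on (coroot D) (roots D) \<and>
     (\<forall>\<alpha>\<in>roots D. pairing D \<alpha> (coroot D \<alpha>) = 2) \<and>
     reduced_roots (roots D) \<and>
     (\<forall>\<alpha>\<in>roots D. reflection D \<alpha> ` roots D = roots D) \<and>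
     (\<forall>\<alpha>\<in>roots D. coreflection D \<alpha> ` coroot D ` roots D = coroot D ` roots D) \<and>
     is_base (roots D) (simple_roots D)"

inductive_set weyl :: "('x::ab_group_add, 'y) root_datum \<Rightarrow> ('x \<Rightarrow> 'x) set" for D where
  weyl_id: "id \<in> weyl D"
| weyl_reflection: "w \<in> weyl D \<Longrightarrow> \<alpha> \<in> roots D \<Longrightarrow> reflection D \<alpha> \<circ> w \<in> weyl D"

definition word_prod :: "('x::ab_group_add, 'y) root_datum \<Rightarrow> 'x list \<Rightarrow> ('x \<Rightarrow> 'x)" where
  "word_prod D \<alpha>s = foldr (\<lambda>\<alpha> w. reflection D \<alpha> \<circ> w) \<alpha>s id"

definition weyl_length :: "('x::ab_group_add, 'y) root_datum \<Rightarrow> ('x \<Rightarrow> 'x) \<Rightarrow> nat" where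
  "weyl_length D w =
     (LEAST n. \<exists>\<alpha>s. set \<alpha>s \<subseteq> simple_roots D \<and> length \<alpha>s = n \<and> word_prod D \<alpha>s = w)"

definition longest_element :: "('x::ab_group_add, 'y) root_datum \<Rightarrow> ('x \<Rightarrow> 'x) \<Rightarrow> bool" where
  "longest_element D w0 \<longleftrightarrow>
     w0 \<in> weyl D \<and> (\<forall>w\<in>weyl D. weyl_length D w \<le> weyl_length D w0)"

section \<open>Affine Hecke algebras\<close>

definition coroot_even :: "('x, 'y::ab_group_add) root_datum \<Rightarrow> 'x \<Rightarrow> bool" where
  "coroot_even D \<alpha> \<longleftrightarrow> (\<exists>y. coroot D \<alpha> = y + y)"

definition hecke_parameters ::
    "('x::ab_group_add, 'y::ab_group_add) root_datum \<Rightarrow> real \<Rightarrow> ('x \<Rightarrow> real) \<Rightarrow> ('x \<Rightarrow> real) \<Rightarrow> bool"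
  where
  "hecke_parameters D q l ls \<longleftrightarrow> q > 1 \<and>
     (\<forall>\<alpha>\<in>roots D. l \<alpha> \<noteq> 0 \<and> ls \<alpha> \<noteq> 0 \<and>
        (\<forall>w\<in>weyl D. l (w \<alpha>) = l \<alpha> \<and> ls (w \<alpha>) = ls \<alpha>) \<and>
        (if coroot_even D \<alpha> then l \<alpha> + ls \<alpha> \<noteq> 0 else l \<alpha> = ls \<alpha>))"

text \<open>A complex algebra on the ring type \<open>'h\<close>, with the elements \<open>\<theta>\<^sub>x\<close> and \<open>T\<^sub>w\<close>.\<close>

record ('x, 'h) hecke_data =
  smul :: "complex \<Rightarrow> 'h \<Rightarrow> 'h"
  theta :: "'x \<Rightarrow> 'h"
  TT :: "('x \<Rightarrow> 'x) \<Rightarrow> 'h"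

definition complex_algebra :: "(complex \<Rightarrow> 'h::ring_1 \<Rightarrow> 'h) \<Rightarrow> bool" where
  "complex_algebra s \<longleftrightarrow> vector_space s \<and>
     (\<forall>c a b. s c (a * b) = s c a * b \<and> s c (a * b) = a * s c b)"

text \<open>The quotient \<open>a / b\<close> formed in the commutative domain spanned by the \<open>\<theta>\<^sub>x\<close>.\<close>

definition theta_quotient :: "('x, 'h::ring_1) hecke_data \<Rightarrow> 'h \<Rightarrow> 'h \<Rightarrow> 'h" where
  "theta_quotient A a b = (THE d. d \<in> module.span (smul A) (range (theta A)) \<and> d * b = a)"

definition bernstein_relation ::
    "('x::ab_group_add, 'y::ab_group_add) root_datum \<Rightarrow> real \<Rightarrow> ('x \<Rightarrow> real) \<Rightarrow> ('x \<Rightarrow> real) \<Rightarrow>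
     ('x, 'h::ring_1) hecke_data \<Rightarrow> 'x \<Rightarrow> 'x \<Rightarrow> bool" where
  "bernstein_relation D q l ls A \<alpha> x \<longleftrightarrow>
     (let s = reflection D \<alpha>;
          sc = (\<lambda>r::real. smul A (complex_of_real r) 1);
          \<theta> = theta A;
          T = TT A s
      in if coroot_even D \<alpha>
         then T * \<theta> x = \<theta> (s x) * T
                + (sc (q powr l \<alpha> - 1)
                    + \<theta> (- \<alpha>) * sc (q powr ((l \<alpha> + ls \<alpha>) / 2) - q powr ((l \<alpha> - ls \<alpha>) / 2)))
                  * theta_quotient A (\<theta> x - \<theta> (s x)) (1 - \<theta> (- (\<alpha> + \<alpha>)))
         else T * \<theta> x = \<theta> (s x) * T
                + sc (q powr l \<alpha> - 1) * theta_quotient A (\<theta> x - \<theta> (s x)) (1 - \<theta> (- \<alpha>)))"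

text \<open>The Bernstein presentation determines the algebra up to a unique isomorphism preserving the
  \<open>\<theta>\<^sub>x\<close> and \<open>T\<^sub>w\<close>, so the affine Hecke algebra is given by its characterizing properties.  The
  normalizations \<open>\<theta>\<^sub>0 = 1\<close> and \<open>T\<^sub>e = 1\<close> follow from the basis property and the relations.\<close>

definition affine_hecke_algebra ::
    "('x::ab_group_add, 'y::ab_group_add) root_datum \<Rightarrow> real \<Rightarrow> ('x \<Rightarrow> real) \<Rightarrow> ('x \<Rightarrow> real) \<Rightarrow>
     ('x, 'h::ring_1) hecke_data \<Rightarrow> bool" where
  "affine_hecke_algebra D q l ls A \<longleftrightarrow>
     reduced_based_root_datum D \<and> hecke_parameters D q l ls \<and> complex_algebra (smul A) \<and>
     (let b = (\<lambda>(x, w). theta A x * TT A w); I = UNIV \<times> weyl D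
      in inj_on b I \<and> \<not> module.dependent (smul A) (b ` I) \<and>
         module.span (smul A) (b ` I) = UNIV) \<and>
     (\<forall>w\<in>weyl D. \<forall>w'\<in>weyl D.
        weyl_length D (w \<circ> w') = weyl_length D w + weyl_length D w' \<longrightarrow>
        TT A w * TT A w' = TT A (w \<circ> w')) \<and>
     (\<forall>\<alpha>\<in>simple_roots D.
        (TT A (reflection D \<alpha>) + 1)
          * (TT A (reflection D \<alpha>) - smul A (complex_of_real (q powr l \<alpha>)) 1) = 0) \<and>
     (\<forall>x y. theta A x * theta A y = theta A (x + y)) \<and>
     (\<forall>\<alpha>\<in>simple_roots D. \<forall>x. bernstein_relation D q l ls A \<alpha> x)"

definition ring_inverse :: "'h::ring_1 \<Rightarrow> 'h" where
  "ring_inverse a = (THE b. a * b = 1 \<and> b * a = 1)"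

text \<open>The longest element is unique, so the quantifier over \<open>w0\<close> only avoids a definite
  description.\<close>

definition hecke_star ::
    "('x::ab_group_add, 'y) root_datum \<Rightarrow> ('x, 'h::ring_1) hecke_data \<Rightarrow> ('h \<Rightarrow> 'h) \<Rightarrow> bool" where
  "hecke_star D A st \<longleftrightarrow>
     bij st \<and> (\<forall>a b. st (a + b) = st a + st b) \<and>
     (\<forall>c a. st (smul A c a) = smul A (cnj c) (st a)) \<and>
     (\<forall>a b. st (a * b) = st b * st a) \<and>
     (\<forall>w\<in>weyl D. st (TT A w) = TT A (inv w)) \<and>
     (\<forall>w0. longest_element D w0 \<longrightarrow>
        (\<forall>x. st (theta A x) = TT A w0 * theta A (- w0 x) * ring_inverse (TT A w0)))"

section \<open>Modules\<close>

text \<open>A module lives on a subspace \<^term>\<open>carrier\<close> of an ambient complex vector space.\<close>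

record ('h, 'v) hmodule =
  carrier :: "'v set"
  scal :: "complex \<Rightarrow> 'v \<Rightarrow> 'v"
  act :: "'h \<Rightarrow> 'v \<Rightarrow> 'v"

definition hecke_module ::
    "('x, 'h::ring_1) hecke_data \<Rightarrow> ('h, 'v::ab_group_add) hmodule \<Rightarrow> bool" where
  "hecke_module A M \<longleftrightarrow>
     vector_space (scal M) \<and> module.subspace (scal M) (carrier M) \<and>
     (\<forall>h. \<forall>v\<in>carrier M. act M h v \<in> carrier M) \<and>
     (\<forall>h. \<forall>v\<in>carrier M. \<forall>v'\<in>carrier M. act M h (v + v') = act M h v + act M h v') \<and>
     (\<forall>c h. \<forall>v\<in>carrier M. act M h (scal M c v) = scal M c (act M h v)) \<and>
     (\<forall>h h'. \<forall>v\<in>carrier M. act M (h + h') v = act M h v + act M h' v) \<and>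
     (\<forall>c h. \<forall>v\<in>carrier M. act M (smul A c h) v = scal M c (act M h v)) \<and>
     (\<forall>h h'. \<forall>v\<in>carrier M. act M (h * h') v = act M h (act M h' v)) \<and>
     (\<forall>v\<in>carrier M. act M 1 v = v)"

definition restrict_module :: "('h1 \<Rightarrow> 'h2) \<Rightarrow> ('h2, 'v) hmodule \<Rightarrow> ('h1, 'v) hmodule" where
  "restrict_module \<phi> M = \<lparr>carrier = carrier M, scal = scal M, act = (\<lambda>h. act M (\<phi> h))\<rparr>"

text \<open>Functionals on \<^term>\<open>carrier M\<close> are represented by functions vanishing outside of it.\<close>

definition hermitian_dual ::
    "('h \<Rightarrow> 'h) \<Rightarrow> ('h, 'v::ab_group_add) hmodule \<Rightarrow> ('h, 'v \<Rightarrow> complex) hmodule" where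
  "hermitian_dual st M =
     \<lparr>carrier = {\<mu>. (\<forall>v\<in>carrier M. \<forall>v'\<in>carrier M. \<mu> (v + v') = \<mu> v + \<mu> v') \<and>
                    (\<forall>c. \<forall>v\<in>carrier M. \<mu> (scal M c v) = cnj c * \<mu> v) \<and>
                    (\<forall>v. v \<notin> carrier M \<longrightarrow> \<mu> v = 0)},
      scal = (\<lambda>c \<mu> v. c * \<mu> v),
      act = (\<lambda>h \<mu> v. if v \<in> carrier M then \<mu> (act M (st h) v) else 0)\<rparr>"

definition hermitian_form ::
    "('h, 'v::ab_group_add) hmodule \<Rightarrow> ('v \<Rightarrow> 'v \<Rightarrow> complex) \<Rightarrow> bool" where
  "hermitian_form M B \<longleftrightarrow>
     (\<forall>u\<in>carrier M. \<forall>v\<in>carrier M. \<forall>w\<in>carrier M. B (u + v) w = B u w + B v w) \<and>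
     (\<forall>c. \<forall>v\<in>carrier M. \<forall>w\<in>carrier M. B (scal M c v) w = c * B v w) \<and>
     (\<forall>v\<in>carrier M. \<forall>w\<in>carrier M. B w v = cnj (B v w))"

definition star_invariant ::
    "('h \<Rightarrow> 'h) \<Rightarrow> ('h, 'v) hmodule \<Rightarrow> ('v \<Rightarrow> 'v \<Rightarrow> complex) \<Rightarrow> bool" where
  "star_invariant st M B \<longleftrightarrow>
     (\<forall>h. \<forall>v\<in>carrier M. \<forall>w\<in>carrier M. B (act M h v) w = B v (act M (st h) w))"

text \<open>\<open>B v v\<close> is real for a hermitian form.\<close>

definition unitary :: "('h \<Rightarrow> 'h) \<Rightarrow> ('h, 'v::ab_group_add) hmodule \<Rightarrow> bool" where
  "unitary st M \<longleftrightarrow>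
     (\<exists>B. hermitian_form M B \<and> (\<forall>v\<in>carrier M. v \<noteq> 0 \<longrightarrow> 0 < Re (B v v)) \<and>
          star_invariant st M B)"

definition finite_dim :: "('h, 'v::ab_group_add) hmodule \<Rightarrow> bool" where
  "finite_dim M \<longleftrightarrow> (\<exists>S. finite S \<and> module.span (scal M) S = carrier M)"

definition is_submodule :: "('h, 'v::ab_group_add) hmodule \<Rightarrow> 'v set \<Rightarrow> bool" where
  "is_submodule M N \<longleftrightarrow> N \<subseteq> carrier M \<and> module.subspace (scal M) N \<and>
     (\<forall>h. \<forall>v\<in>N. act M h v \<in> N)"

definition simple_module :: "('h, 'v::ab_group_add) hmodule \<Rightarrow> bool" where
  "simple_module M \<longleftrightarrow> carrier M \<noteq> {0} \<and>
     (\<forall>N. is_submodule M N \<longrightarrow> N = {0} \<or> N = carrier M)"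

definition internal_direct_sum ::
    "('h, 'v::ab_group_add) hmodule \<Rightarrow> 'i set \<Rightarrow> ('i \<Rightarrow> 'v set) \<Rightarrow> bool" where
  "internal_direct_sum M I N \<longleftrightarrow> finite I \<and> (\<forall>i\<in>I. is_submodule M (N i)) \<and>
     (\<forall>v\<in>carrier M. \<exists>!s. s \<in> Pi\<^sub>E I N \<and> v = (\<Sum>i\<in>I. s i))"

section \<open>Central morphisms\<close>

definition transpose_map ::
    "('x1, 'y1) root_datum \<Rightarrow> ('x2, 'y2) root_datum \<Rightarrow> ('x1 \<Rightarrow> 'x2) \<Rightarrow> 'y2 \<Rightarrow> 'y1" where
  "transpose_map D1 D2 f y = (THE y'. \<forall>x. pairing D1 x y' = pairing D2 (f x) y)"

text \<open>Isomorphisms of the real spans carrying roots to roots and coroots to coroots are the same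
  thing as isomorphisms of the integer spans doing so; the latter are used here.\<close>

definition central_root_morphism ::
    "('x1::ab_group_add, 'y1::ab_group_add) root_datum \<Rightarrow>
     ('x2::ab_group_add, 'y2::ab_group_add) root_datum \<Rightarrow> ('x1 \<Rightarrow> 'x2) \<Rightarrow> bool" where
  "central_root_morphism D1 D2 f \<longleftrightarrow>
     additive f \<and>
     bij_betw f (module.span zscale (roots D1)) (module.span zscale (roots D2)) \<and>
     f ` roots D1 = roots D2 \<and> f ` simple_roots D1 = simple_roots D2 \<and>
     bij_betw (transpose_map D1 D2 f) (module.span zscale (coroot D2 ` roots D2))
       (module.span zscale (coroot D1 ` roots D1)) \<and>
     (\<forall>\<alpha>\<in>roots D1. transpose_map D1 D2 f (coroot D2 (f \<alpha>)) = coroot D1 \<alpha>)"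

text \<open>The identification of Weyl groups: \<open>w\<close> corresponds to the unique element making \<open>f\<close>
  equivariant.\<close>

definition weyl_map ::
    "('x2::ab_group_add, 'y2) root_datum \<Rightarrow> ('x1 \<Rightarrow> 'x2) \<Rightarrow> ('x1 \<Rightarrow> 'x1) \<Rightarrow> ('x2 \<Rightarrow> 'x2)" where
  "weyl_map D2 f w = (THE w'. w' \<in> weyl D2 \<and> w' \<circ> f = f \<circ> w)"

definition algebra_hom ::
    "('x1, 'h1::ring_1) hecke_data \<Rightarrow> ('x2, 'h2::ring_1) hecke_data \<Rightarrow> ('h1 \<Rightarrow> 'h2) \<Rightarrow> bool" where
  "algebra_hom A1 A2 \<phi> \<longleftrightarrow> Vector_Spaces.linear (smul A1) (smul A2) \<phi> \<and>
     \<phi> 1 = 1 \<and> (\<forall>a b. \<phi> (a * b) = \<phi> a * \<phi> b)"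

definition central_hecke_morphism ::
    "('x1::ab_group_add, 'y1::ab_group_add) root_datum \<Rightarrow> ('x1 \<Rightarrow> real) \<Rightarrow> ('x1 \<Rightarrow> real) \<Rightarrow>
     ('x1, 'h1::ring_1) hecke_data \<Rightarrow>
     ('x2::ab_group_add, 'y2::ab_group_add) root_datum \<Rightarrow> ('x2 \<Rightarrow> real) \<Rightarrow> ('x2 \<Rightarrow> real) \<Rightarrow>
     ('x2, 'h2::ring_1) hecke_data \<Rightarrow> ('h1 \<Rightarrow> 'h2) \<Rightarrow> bool" where
  "central_hecke_morphism D1 l1 ls1 A1 D2 l2 ls2 A2 \<phi> \<longleftrightarrow>
     (\<exists>f. central_root_morphism D1 D2 f \<and>
          (\<forall>\<alpha>\<in>roots D1. l2 (f \<alpha>) = l1 \<alpha> \<and> ls2 (f \<alpha>) = ls1 \<alpha>) \<and>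
          algebra_hom A1 A2 \<phi> \<and>
          (\<forall>x. \<forall>w\<in>weyl D1. \<phi> (theta A1 x * TT A1 w) = theta A2 (f x) * TT A2 (weyl_map D2 f w)))"

section \<open>Well-definedness\<close>

lemma zscale_0 [simp]: "zscale 0 x = 0"
  by (simp add: zscale_def)

lemma zscale_plus_1: "zscale (n + 1) x = zscale n x + x"
proof (cases "0 \<le> n")
  case True
  then have "nat (n + 1) = Suc (nat n)" by simp
  with True show ?thesis by (simp add: zscale_def)
next
  case False
  then have "nat (- n) = Suc (nat (- (n + 1)))" by simp
  with False show ?thesis by (cases "n = - 1") (simp_all add: zscale_def)
qed

lemma zscale_minus_1: "zscale (n - 1) x = zscale n x - x"
  using zscale_plus_1[of "n - 1" x] by (simp add: algebra_simps)

lemma zscale_1: "zscale 1 x = x"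
  using zscale_plus_1[of 0 x] by simp

lemma zscale_add_right: "zscale n (x + y) = zscale n x + zscale n y"
  by (induction n rule: int_induct[where k = 0])
    (simp_all add: zscale_plus_1 zscale_minus_1)

lemma zscale_add_left: "zscale (m + n) x = zscale m x + zscale n x"
proof (induction n rule: int_induct[where k = 0])
  case (step1 i)
  then show ?case
    by (simp only: add.assoc[symmetric] zscale_plus_1)
next
  case (step2 i)
  then show ?case
    by (simp only: add_diff_eq zscale_minus_1)
qed simp

lemma zscale_zscale: "zscale m (zscale n x) = zscale (m * n) x"
proof (induction m rule: int_induct[where k = 0])
  case (step1 i)
  then show ?case
    by (simp add: zscale_plus_1 distrib_right zscale_add_left zscale_1)
next
  case (step2 i)
  have "zscale ((i - 1) * n) x = zscale (i * n) x - zscale n x"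
    using zscale_add_left[of "(i - 1) * n" n x] by (simp add: algebra_simps)
  with step2 show ?case by (simp add: zscale_minus_1)
qed simp

interpretation zscale: module zscale
  by unfold_locales (simp_all add: zscale_add_right zscale_add_left zscale_zscale zscale_1)

lemma hecke_module_restrict_module:
  assumes "hecke_module A2 M" "algebra_hom A1 A2 \<phi>"
  shows "hecke_module A1 (restrict_module \<phi> M)"
proof -
  have "\<phi> (a + b) = \<phi> a + \<phi> b" "\<phi> (smul A1 c a) = smul A2 c (\<phi> a)" for a b c
    using assms(2) by (auto simp: algebra_hom_def Vector_Spaces.linear.axioms
      dest: module_hom.add module_hom.scale Vector_Spaces.linear.axioms(3))
  moreover have "\<phi> 1 = 1" "\<phi> (a * b) = \<phi> a * \<phi> b" for a b
    using assms(2) by (auto simp: algebra_hom_def)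
  ultimately show ?thesis
    using assms(1) by (simp add: hecke_module_def restrict_module_def)
qed

lemma hecke_module_hermitian_dual:
  assumes st: "hecke_star D A st" and M: "hecke_module A M"
  shows "hecke_module A (hermitian_dual st M)"
proof -
  let ?V = "hermitian_dual st M"
  have sub: "module.subspace (scal M) (carrier M)" and vs: "vector_space (scal M)"
    using M by (auto simp: hecke_module_def)
  interpret V: vector_space "scal M" by fact
  have cl: "v + w \<in> carrier M" "scal M c v \<in> carrier M" "act M h v \<in> carrier M"
    if "v \<in> carrier M" "w \<in> carrier M" for v w c h
    using sub that M by (auto simp: V.subspace_def hecke_module_def)
  have vs': "vector_space (scal ?V)"
    by unfold_locales (auto simp: hermitian_dual_def fun_eq_iff algebra_simps)
  interpret W: vector_space "scal ?V" by fact
  have s: "st (a + b) = st a + st b" "st (smul A c a) = smul A (cnj c) (st a)"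
    "st (a * b) = st b * st a" for a b c
    using st by (auto simp: hecke_star_def)
  obtain e where "st e = 1" using st by (metis hecke_star_def bij_pointE)
  with s(3)[of e 1] have st1: "st 1 = 1" by simp
  have "module.subspace (scal ?V) (carrier ?V)"
    using cl unfolding W.subspace_def by (auto simp: hermitian_dual_def algebra_simps)
  with vs' show ?thesis
    using M cl unfolding hecke_module_def
    by (auto simp: hermitian_dual_def fun_eq_iff s st1)
qed

end

theory Submission
  imports Defs
begin

text \<open>The point is that a central morphism \<open>\<phi>\<close> intertwines the star operations.  On \<open>T\<^sub>w\<close> this is the
  compatibility of the identification of Weyl groups with inverses.  On \<open>\<theta>\<^sub>x\<close> it amounts to \<open>f\<close> carrying
  a longest element to a longest element, which holds because a Weyl group element is determined by
  its action on the roots; this faithfulness comes from the invariant forms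
  \<open>\<Sum>\<^sub>\<alpha> \<langle>x, \<alpha>\<^sup>\<or>\<rangle>\<langle>x', \<alpha>\<^sup>\<or>\<rangle>\<close> and \<open>\<Sum>\<^sub>\<alpha> \<langle>\<alpha>, y\<rangle>\<langle>\<alpha>, y'\<rangle>\<close>.  Finally, in a finite-dimensional unitary
  module the orthogonal complement of a submodule of minimal positive dimension is a submodule, so one
  can split off simple submodules by induction on the dimension.\<close>

section \<open>Root data and their Weyl groups\<close>

lemma additive_zscale:
  assumes "additive f"
  shows "f (zscale n x) = zscale n (f x)"
proof -
  interpret additive f by fact
  show ?thesis by (simp add: zscale_def sum minus)
qed

lemma zscale_int [simp]: "zscale n (k::int) = n * k"
  by (auto simp: zscale_def)

lemma additive_eq_on_span:
  assumes "additive f" "additive g" and "\<And>b. b \<in> S \<Longrightarrow> f b = g b"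
    and "x \<in> zscale.span S"
  shows "f x = g x"
  using assms(4)
proof (induction rule: zscale.span_induct_alt)
  case base
  show ?case using assms(1,2) by (simp add: additive.zero)
next
  case (step c a b)
  then show ?case using assms(1-3) by (simp add: additive.add additive_zscale)
qed

text \<open>A map of a finite set onto itself is injective by cardinality, so the sum may be
  reindexed. The maps in question are reflections permuting roots and coreflections permuting
  coroots.\<close>

lemma sum_image_eq:
  assumes "finite C" "r ` C = C"
  shows "(\<Sum>c\<in>C. g (r c)) = sum g C"
  using sum.reindex[of r C g] assms by (simp add: eq_card_imp_inj_on)

section \<open>The pairing and the reflections of a root datum\<close>

locale based_root_datum =
  fixes D :: "('x::ab_group_add, 'y::ab_group_add) root_datum"
  assumes datum: "reduced_based_root_datum D"
begin

lemma finite_roots: "finite (roots D)"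
  and pairing_root_coroot: "\<alpha> \<in> roots D \<Longrightarrow> pairing D \<alpha> (coroot D \<alpha>) = 2"
  and reflection_roots: "\<alpha> \<in> roots D \<Longrightarrow> reflection D \<alpha> ` roots D = roots D"
  and coreflection_coroots:
    "\<alpha> \<in> roots D \<Longrightarrow> coreflection D \<alpha> ` coroot D ` roots D = coroot D ` roots D"
  and simple_roots_subset: "simple_roots D \<subseteq> roots D"
  and perfect: "perfect_pairing (pairing D)"
  using datum by (auto simp: reduced_based_root_datum_def is_base_def)

lemma additive_pairing: "additive (\<lambda>x. pairing D x y)" "additive (pairing D x)"
  using perfect by (auto simp: perfect_pairing_def)

lemmas pairing_simps =
  additive.add[OF additive_pairing(1)] additive.add[OF additive_pairing(2)]
  additive.diff[OF additive_pairing(1)] additive.diff[OF additive_pairing(2)]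
  additive.minus[OF additive_pairing(1)] additive.minus[OF additive_pairing(2)]
  additive.zero[OF additive_pairing(1)] additive.zero[OF additive_pairing(2)]
  additive_zscale[OF additive_pairing(1)] additive_zscale[OF additive_pairing(2)]

text \<open>Perfectness includes uniqueness of the vector representing the zero functional, and
  \<open>0\<close> represents it.\<close>

lemma pairing_eq_0D: "(\<And>y. pairing D x y = 0) \<Longrightarrow> x = 0"
proof -
  assume x: "\<And>y. pairing D x y = 0"
  have "additive (\<lambda>_::'y. 0::int)" by unfold_locales simp
  then have "\<exists>!x. \<forall>y. pairing D x y = 0"
    using perfect unfolding perfect_pairing_def by blast
  with x pairing_simps(7) show "x = 0" by blast
qed

lemma additive_reflection: "additive (reflection D \<alpha>)"
  by unfold_locales (simp add: reflection_def pairing_simps zscale_add_left)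

lemma reflection_reflection:
  assumes "\<alpha> \<in> roots D"
  shows "reflection D \<alpha> \<circ> reflection D \<alpha> = id"
proof
  fix x
  let ?n = "pairing D x (coroot D \<alpha>)"
  have "pairing D (reflection D \<alpha> x) (coroot D \<alpha>) = - ?n"
    using assms by (simp add: reflection_def pairing_simps pairing_root_coroot)
  then have "reflection D \<alpha> (reflection D \<alpha> x) = reflection D \<alpha> x - zscale (- ?n) \<alpha>"
    by (simp add: reflection_def)
  also have "\<dots> = x"
    by (simp add: reflection_def zscale.scale_minus_left)
  finally show "(reflection D \<alpha> \<circ> reflection D \<alpha>) x = id x" by simp
qed

section \<open>Invariant forms on the two lattices\<close>

lemma pairing_reflection:
  "pairing D (reflection D \<alpha> x) y = pairing D x (coreflection D \<alpha> y)"
  by (simp add: reflection_def coreflection_def pairing_simps)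

text \<open>The sum runs over the set of coroots because this is the set that coreflections are
  known to permute. The form vanishes on vectors orthogonal to all coroots, so it can be
  degenerate.\<close>

definition coroot_form :: "'x \<Rightarrow> 'x \<Rightarrow> int" where
  "coroot_form x x' = (\<Sum>c\<in>coroot D ` roots D. pairing D x c * pairing D x' c)"

definition root_form :: "'y \<Rightarrow> 'y \<Rightarrow> int" where
  "root_form y y' = (\<Sum>\<alpha>\<in>roots D. pairing D \<alpha> y * pairing D \<alpha> y')"

text \<open>Moving the reflection across the pairing turns it into the coreflection, which merely
  permutes the coroots summed over.\<close>

lemma coroot_form_reflection:
  assumes "\<beta> \<in> roots D"
  shows "coroot_form (reflection D \<beta> x) (reflection D \<beta> x') = coroot_form x x'"
  unfolding coroot_form_def pairing_reflection
  by (rule sum_image_eq) (simp_all add: finite_roots coreflection_coroots assms)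

lemma additive_coroot_form: "additive (coroot_form x)"
  by unfold_locales (simp add: coroot_form_def pairing_simps distrib_left sum.distrib)

lemma coroot_form_commute: "coroot_form x x' = coroot_form x' x"
  by (simp add: coroot_form_def mult.commute)

lemma additive_root_form: "additive (\<lambda>u. root_form u y)"
  by unfold_locales (simp add: root_form_def pairing_simps distrib_right sum.distrib)

text \<open>On the diagonal the form is a sum of integer squares, so each square vanishes.\<close>

lemma coroot_form_eq_0D:
  assumes "coroot_form x x = 0" "\<alpha> \<in> roots D"
  shows "pairing D x (coroot D \<alpha>) = 0"
  using assms finite_roots by (simp add: coroot_form_def sum_nonneg_eq_0_iff)

lemma root_form_eq_0D:
  assumes "root_form y y = 0" "\<alpha> \<in> roots D"
  shows "pairing D \<alpha> y = 0"
  using assms finite_roots by (simp add: root_form_def sum_nonneg_eq_0_iff)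

text \<open>Reindexing by the reflection in \<open>\<alpha>\<close> negates the pairing with the
  coroot; expanding the other factor returns the original sum with a minus sign. Thus the root form
  against a coroot is proportional to the pairing with its root.\<close>

lemma root_form_coroot:
  assumes "\<alpha> \<in> roots D"
  shows "2 * root_form (coroot D \<alpha>) y = root_form (coroot D \<alpha>) (coroot D \<alpha>) * pairing D \<alpha> y"
proof -
  let ?a = "coroot D \<alpha>"
  have "root_form ?a y =
      (\<Sum>\<beta>\<in>roots D. pairing D (reflection D \<alpha> \<beta>) ?a * pairing D (reflection D \<alpha> \<beta>) y)"
    unfolding root_form_def
    by (rule sum_image_eq[symmetric]) (simp_all add: finite_roots reflection_roots assms)
  also have "\<dots> = (\<Sum>\<beta>\<in>roots D. pairing D \<beta> ?a * pairing D \<beta> ?a * pairing D \<alpha> y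
      - pairing D \<beta> ?a * pairing D \<beta> y)"
    using assms
    by (intro sum.cong) (simp_all add: reflection_def pairing_simps pairing_root_coroot algebra_simps)
  also have "\<dots> = root_form ?a ?a * pairing D \<alpha> y - root_form ?a y"
    by (simp add: root_form_def sum_subtractf sum_distrib_right)
  finally show ?thesis by simp
qed

text \<open>No summand is negative, and the summand of \<open>\<alpha>\<close> itself comes from a
  pairing equal to 2.\<close>

lemma root_form_coroot_pos:
  assumes "\<alpha> \<in> roots D"
  shows "root_form (coroot D \<alpha>) (coroot D \<alpha>) > 0"
proof -
  have "root_form (coroot D \<alpha>) (coroot D \<alpha>) \<ge> 0"
    by (simp add: root_form_def sum_nonneg)
  moreover have "root_form (coroot D \<alpha>) (coroot D \<alpha>) \<noteq> 0"
    using root_form_eq_0D[OF _ assms] pairing_root_coroot[OF assms] by force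
  ultimately show ?thesis by simp
qed

text \<open>Up to a positive factor, the root form identifies the root lattice with the coroot lattice.\<close>

lemma root_span_root_form:
  assumes "t \<in> zscale.span (roots D)"
  shows "\<exists>m>0. \<exists>u\<in>zscale.span (coroot D ` roots D). \<forall>y. m * pairing D t y = root_form u y"
  using assms
proof (induction rule: zscale.span_induct_alt)
  case base
  show ?case
    by (intro exI[of _ 1] conjI bexI[of _ 0])
      (auto simp: pairing_simps root_form_def zscale.span_zero)
next
  case (step n \<alpha> t)
  then obtain m u where mu: "m > 0" "u \<in> zscale.span (coroot D ` roots D)"
    "\<And>y. m * pairing D t y = root_form u y" by blast
  let ?a = "coroot D \<alpha>"
  let ?b = "root_form ?a ?a"
  have b: "?b > 0" using step by (simp add: root_form_coroot_pos)
  \<comment> \<open>By \<open>root_form_coroot\<close>, \<open>?b\<close> times the pairing with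
    \<open>\<alpha>\<close> is twice the form against \<open>?a\<close>. Multiplying by
    \<open>?b * m\<close> therefore clears all denominators and dictates the witness.\<close>
  show ?case
  proof (intro exI[of _ "?b * m"] conjI bexI[of _ "zscale (2 * n * m) ?a + zscale ?b u"] allI)
    show "?b * m > 0" using b mu by simp
    show "zscale (2 * n * m) ?a + zscale ?b u \<in> zscale.span (coroot D ` roots D)"
      using mu step by (intro zscale.span_add zscale.span_scale) (auto intro: zscale.span_base)
    fix y
    have "?b * m * pairing D (zscale n \<alpha> + t) y
        = n * m * (?b * pairing D \<alpha> y) + ?b * (m * pairing D t y)"
      by (simp add: pairing_simps algebra_simps)
    also have "\<dots> = 2 * n * m * root_form ?a y + ?b * root_form u y"
      using root_form_coroot[of \<alpha> y] step mu by simp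
    finally show "?b * m * pairing D (zscale n \<alpha> + t) y
        = root_form (zscale (2 * n * m) ?a + zscale ?b u) y"
      by (simp add: additive.add[OF additive_root_form] additive_zscale[OF additive_root_form])
  qed
qed

text \<open>Write a positive multiple of the pairing with \<open>t\<close> as
  \<open>root_form u\<close> with \<open>u\<close> in the coroot span. Then \<open>t\<close> is
  orthogonal to \<open>u\<close>, so \<open>root_form u u = 0\<close>, all roots kill
  \<open>u\<close>, and the pairing with \<open>t\<close> vanishes identically.\<close>

lemma root_span_orthogonal_coroots:
  assumes "t \<in> zscale.span (roots D)" and "\<And>\<alpha>. \<alpha> \<in> roots D \<Longrightarrow> pairing D t (coroot D \<alpha>) = 0"
  shows "t = 0"
proof -
  obtain m u where mu: "m > 0" "u \<in> zscale.span (coroot D ` roots D)"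
    "\<And>y. m * pairing D t y = root_form u y"
    using root_span_root_form[OF assms(1)] by blast
  have "additive (\<lambda>_::'y. 0::int)" by unfold_locales simp
  then have "pairing D t u = 0"
    using additive_eq_on_span[OF additive_pairing(2) _ _ mu(2)] assms(2) by blast
  then have "root_form u u = 0" using mu(3)[of u] by simp
  then have "pairing D \<alpha> u = 0" if "\<alpha> \<in> roots D" for \<alpha>
    using root_form_eq_0D that by blast
  then have "root_form u y = 0" for y
    by (simp add: root_form_def)
  with mu(1,3) have "pairing D t y = 0" for y
    by (metis mult_eq_0_iff less_irrefl)
  then show ?thesis by (rule pairing_eq_0D)
qed

section \<open>The Weyl group and its action on the roots\<close>

lemma additive_weyl: "w \<in> weyl D \<Longrightarrow> additive w"
proof (induction rule: weyl.induct)
  case weyl_id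
  show ?case by unfold_locales simp
next
  case (weyl_reflection w \<alpha>)
  then show ?case
    using additive_reflection[of \<alpha>] by (simp add: additive_def)
qed

lemma reflection_weyl: "\<alpha> \<in> roots D \<Longrightarrow> reflection D \<alpha> \<in> weyl D"
  using weyl.intros(2)[OF weyl.intros(1)] by simp

lemma weyl_comp: "w \<in> weyl D \<Longrightarrow> v \<in> weyl D \<Longrightarrow> w \<circ> v \<in> weyl D"
  by (induction rule: weyl.induct) (auto simp: comp_assoc intro: weyl.intros)

lemma weyl_inverse:
  assumes "w \<in> weyl D"
  obtains v where "v \<in> weyl D" "v \<circ> w = id" "w \<circ> v = id"
  using assms
proof (induction arbitrary: thesis rule: weyl.induct)
  case weyl_id
  show ?case by (rule weyl_id, rule weyl.intros(1)) simp_all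
next
  case (weyl_reflection w \<alpha>)
  let ?s = "reflection D \<alpha>"
  obtain v where v: "v \<in> weyl D" "v \<circ> w = id" "w \<circ> v = id"
    using weyl_reflection.IH by blast
  have ss: "?s (?s x) = x" for x
    using reflection_reflection[of \<alpha>] weyl_reflection.hyps by (simp add: fun_eq_iff)
  show ?case
  proof (rule weyl_reflection.prems)
    show "v \<circ> ?s \<in> weyl D"
      using v weyl_reflection.hyps by (intro weyl_comp reflection_weyl)
    show "v \<circ> ?s \<circ> (?s \<circ> w) = id" "?s \<circ> w \<circ> (v \<circ> ?s) = id"
      using v ss by (auto simp: fun_eq_iff)
  qed
qed

lemma inv_weyl: "w \<in> weyl D \<Longrightarrow> inv w \<in> weyl D"
  and bij_weyl: "w \<in> weyl D \<Longrightarrow> bij w"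
proof -
  assume "w \<in> weyl D"
  then obtain v where v: "v \<in> weyl D" "v \<circ> w = id" "w \<circ> v = id"
    by (rule weyl_inverse)
  then show "inv w \<in> weyl D" using inv_unique_comp[of w v] by simp
  show "bij w" using v(2,3) by (rule o_bij)
qed

lemma weyl_root: "w \<in> weyl D \<Longrightarrow> \<alpha> \<in> roots D \<Longrightarrow> w \<alpha> \<in> roots D"
  by (induction rule: weyl.induct) (use reflection_roots in auto)

lemma weyl_coroot_form: "w \<in> weyl D \<Longrightarrow> coroot_form (w x) (w x') = coroot_form x x'"
  by (induction rule: weyl.induct) (simp_all add: coroot_form_reflection)

text \<open>Each reflection moves a vector by a multiple of a root. The roots need not span
  \<open>X\<close>, but displacements stay in their span, where
  \<open>root_span_orthogonal_coroots\<close> applies.\<close>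

lemma weyl_diff_span: "w \<in> weyl D \<Longrightarrow> w x - x \<in> zscale.span (roots D)"
proof (induction rule: weyl.induct)
  case weyl_id
  show ?case by (simp add: zscale.span_zero)
next
  case (weyl_reflection w \<alpha>)
  have "(reflection D \<alpha> \<circ> w) x - x = (w x - x) - zscale (pairing D (w x) (coroot D \<alpha>)) \<alpha>"
    by (simp add: reflection_def)
  with weyl_reflection show ?case
    by (metis zscale.span_diff zscale.span_scale zscale.span_base)
qed

text \<open>For \<open>?t = w x - x\<close>, invariance of the coroot form and
  \<open>w \<alpha> = \<alpha>\<close> make \<open>?t\<close> orthogonal to every root. As
  \<open>?t\<close> lies in the root span, the form vanishes on \<open>?t\<close> itself; hence
  \<open>?t\<close> is orthogonal to all coroots and is zero.\<close>

lemma weyl_faithful: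
  assumes w: "w \<in> weyl D" and fix_roots: "\<And>\<alpha>. \<alpha> \<in> roots D \<Longrightarrow> w \<alpha> = \<alpha>"
  shows "w = id"
proof
  fix x
  let ?t = "w x - x"
  have "coroot_form ?t \<alpha> = 0" if "\<alpha> \<in> roots D" for \<alpha>
    using weyl_coroot_form[OF w, of \<alpha> x] fix_roots[OF that]
    by (simp add: coroot_form_commute[of ?t] additive.diff[OF additive_coroot_form])
  moreover have "additive (\<lambda>_::'x. 0::int)" by unfold_locales simp
  ultimately have "coroot_form ?t ?t = 0"
    using additive_eq_on_span[OF additive_coroot_form _ _ weyl_diff_span[OF w]] by blast
  then have "?t = 0"
    using root_span_orthogonal_coroots[OF weyl_diff_span[OF w]] coroot_form_eq_0D by blast
  then show "w x = id x" by simp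
qed

text \<open>The inverse of \<open>v\<close> composed with \<open>w\<close> fixes every root.\<close>

lemma weyl_eqI:
  assumes "w \<in> weyl D" "v \<in> weyl D" and eq: "\<And>\<alpha>. \<alpha> \<in> roots D \<Longrightarrow> w \<alpha> = v \<alpha>"
  shows "w = v"
proof -
  obtain u where u: "u \<in> weyl D" "u \<circ> v = id" "v \<circ> u = id"
    using weyl_inverse[OF assms(2)] .
  have "u \<circ> w = id"
  proof (rule weyl_faithful)
    show "(u \<circ> w) \<alpha> = \<alpha>" if "\<alpha> \<in> roots D" for \<alpha>
      using eq[OF that] u(2) by (simp add: fun_eq_iff)
  qed (use u assms weyl_comp in blast)
  with u show ?thesis by (metis comp_assoc comp_id id_comp)
qed

text \<open>Restriction to the roots is injective by \<open>weyl_eqI\<close>, and the finite set of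
  roots has only finitely many self-maps.\<close>

lemma finite_weyl: "finite (weyl D)"
proof (rule finite_imageD)
  have "(\<lambda>w. restrict w (roots D)) ` weyl D \<subseteq> roots D \<rightarrow>\<^sub>E roots D"
    using weyl_root by auto
  then show "finite ((\<lambda>w. restrict w (roots D)) ` weyl D)"
    by (rule finite_subset) (simp add: finite_PiE finite_roots)
  show "inj_on (\<lambda>w. restrict w (roots D)) (weyl D)"
  proof (intro inj_onI weyl_eqI)
    fix w v \<alpha>
    assume "restrict w (roots D) = restrict v (roots D)" "\<alpha> \<in> roots D"
    then show "w \<alpha> = v \<alpha>" by (metis restrict_apply')
  qed
qed

lemma longest_element_exists: "\<exists>w0. longest_element D w0"
proof -
  have "weyl D \<noteq> {}" using weyl.intros(1) by blast
  then obtain w0 where "w0 \<in> weyl D" "Max (weyl_length D ` weyl D) = weyl_length D w0"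
    using obtains_MAX[OF finite_weyl] by metis
  then show ?thesis
    using finite_weyl Max_ge[of "weyl_length D ` weyl D"] by (auto simp: longest_element_def)
qed

section \<open>Words in reflections, inverses and length\<close>

lemma word_prod_weyl: "set \<alpha>s \<subseteq> roots D \<Longrightarrow> word_prod D \<alpha>s \<in> weyl D"
  by (induction \<alpha>s) (auto simp: word_prod_def intro: weyl.intros)

lemma word_prod_append: "word_prod D (\<alpha>s @ \<beta>s) = word_prod D \<alpha>s \<circ> word_prod D \<beta>s"
  by (induction \<alpha>s) (auto simp: word_prod_def)

lemma inv_word_prod:
  assumes "set \<alpha>s \<subseteq> roots D"
  shows "inv (word_prod D \<alpha>s) = word_prod D (rev \<alpha>s)"
proof -
  have "word_prod D \<beta>s \<circ> word_prod D (rev \<beta>s) = id" if "set \<beta>s \<subseteq> roots D" for \<beta>s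
    using that
  proof (induction \<beta>s)
    case Nil
    then show ?case by (simp add: word_prod_def)
  next
    case (Cons \<beta> \<beta>s)
    have IH: "word_prod D \<beta>s \<circ> word_prod D (rev \<beta>s) = id"
      using Cons.IH Cons.prems by (simp only: list.set insert_subset)
    have "word_prod D (\<beta> # \<beta>s) \<circ> word_prod D (rev (\<beta> # \<beta>s)) =
        reflection D \<beta> \<circ> (word_prod D \<beta>s \<circ> word_prod D (rev \<beta>s)) \<circ> reflection D \<beta>"
      by (simp add: word_prod_append comp_assoc) (simp add: word_prod_def comp_assoc)
    then show ?case
      unfolding IH using Cons.prems by (simp add: reflection_reflection)
  qed
  \<comment> \<open>The word and its reverse supply the two one-sided inverses.\<close>
  from this[of \<alpha>s] this[of "rev \<alpha>s"] assms show ?thesis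
    by (intro inv_unique_comp) auto
qed

text \<open>Reversing words exchanges expressions of \<open>w\<close> and of its inverse without
  changing their length, so both lengths are \<open>LEAST\<close> over equal predicates.\<close>

lemma weyl_length_inv:
  assumes w: "w \<in> weyl D"
  shows "weyl_length D (inv w) = weyl_length D w"
proof -
  have le: "\<exists>\<beta>s. set \<beta>s \<subseteq> simple_roots D \<and> length \<beta>s = n \<and> word_prod D \<beta>s = inv v"
    if ex: "\<exists>\<alpha>s. set \<alpha>s \<subseteq> simple_roots D \<and> length \<alpha>s = n \<and> word_prod D \<alpha>s = v" for n v
  proof -
    obtain \<alpha>s where "set \<alpha>s \<subseteq> simple_roots D" "length \<alpha>s = n" "word_prod D \<alpha>s = v"
      using ex by blast
    then show ?thesis
      using inv_word_prod[of \<alpha>s] simple_roots_subset by (intro exI[of _ "rev \<alpha>s"]) auto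
  qed
  have "inv (inv w) = w" by (rule inv_inv_eq[OF bij_weyl[OF w]])
  then have "(\<exists>\<alpha>s. set \<alpha>s \<subseteq> simple_roots D \<and> length \<alpha>s = n \<and> word_prod D \<alpha>s = inv w) =
      (\<exists>\<alpha>s. set \<alpha>s \<subseteq> simple_roots D \<and> length \<alpha>s = n \<and> word_prod D \<alpha>s = w)" for n
    using le[where v = w and n = n] le[where v = "inv w" and n = n] by metis
  then show ?thesis by (simp only: weyl_length_def)
qed

lemma longest_element_inv: "longest_element D w0 \<Longrightarrow> longest_element D (inv w0)"
  by (simp add: longest_element_def inv_weyl weyl_length_inv)

lemma weyl_length_id: "weyl_length D id = 0"
proof -
  have "weyl_length D id \<le> 0"
    unfolding weyl_length_def by (rule Least_le) (auto simp: word_prod_def)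
  then show ?thesis by simp
qed

end

section \<open>Central morphisms of root data\<close>

locale central_morphism = R1: based_root_datum D1 + R2: based_root_datum D2
  for D1 :: "('x1::ab_group_add, 'y1::ab_group_add) root_datum"
    and D2 :: "('x2::ab_group_add, 'y2::ab_group_add) root_datum" +
  fixes f :: "'x1 \<Rightarrow> 'x2"
  assumes central: "central_root_morphism D1 D2 f"
begin

lemma additive_f: "additive f"
  and f_roots: "f ` roots D1 = roots D2"
  and f_simple_roots: "f ` simple_roots D1 = simple_roots D2"
  using central by (simp_all add: central_root_morphism_def)

lemma inj_on_roots: "inj_on f (roots D1)"
proof -
  have "inj_on f (zscale.span (roots D1))"
    using central by (simp add: central_root_morphism_def bij_betw_def)
  then show ?thesis by (rule inj_on_subset) (rule zscale.span_superset)
qed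

text \<open>Perfectness of the first pairing represents this additive functional by a unique vector,
  so the definite description in \<open>transpose_map\<close> denotes.\<close>

lemma pairing_transpose: "pairing D1 x (transpose_map D1 D2 f y) = pairing D2 (f x) y"
proof -
  have "additive (\<lambda>x. pairing D2 (f x) y)"
    by unfold_locales (simp add: additive.add[OF additive_f] R2.pairing_simps)
  then have "\<exists>!y'. \<forall>x. pairing D1 x y' = pairing D2 (f x) y"
    using R1.perfect unfolding perfect_pairing_def by blast
  from theI'[OF this] show ?thesis unfolding transpose_map_def by blast
qed

text \<open>The transpose matches the coroots of \<open>f \<alpha>\<close> and
  \<open>\<alpha>\<close>, so both reflections subtract the same integer multiple.\<close>

lemma f_reflection:
  assumes "\<alpha> \<in> roots D1"
  shows "f (reflection D1 \<alpha> x) = reflection D2 (f \<alpha>) (f x)"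
proof -
  have "pairing D2 (f x) (coroot D2 (f \<alpha>)) = pairing D1 x (coroot D1 \<alpha>)"
    using pairing_transpose[of x "coroot D2 (f \<alpha>)"] central assms
    by (simp add: central_root_morphism_def)
  then show ?thesis
    by (simp add: reflection_def additive.diff[OF additive_f] additive_zscale[OF additive_f])
qed

section \<open>The identification of the two Weyl groups\<close>

lemma weyl_exists: "w \<in> weyl D1 \<Longrightarrow> \<exists>v\<in>weyl D2. v \<circ> f = f \<circ> w"
proof (induction rule: weyl.induct)
  case weyl_id
  show ?case by (rule bexI[of _ id]) (simp_all add: weyl.intros(1))
next
  case (weyl_reflection w \<alpha>)
  then obtain v where v: "v \<in> weyl D2" "v \<circ> f = f \<circ> w" by blast
  have "f \<alpha> \<in> roots D2" using weyl_reflection.hyps f_roots by blast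
  then have "reflection D2 (f \<alpha>) \<circ> v \<in> weyl D2" using v weyl.intros(2) by blast
  moreover have "reflection D2 (f \<alpha>) \<circ> v \<circ> f = f \<circ> (reflection D1 \<alpha> \<circ> w)"
    using v(2) weyl_reflection.hyps by (simp add: fun_eq_iff f_reflection)
  ultimately show ?case by blast
qed

text \<open>Although \<open>f\<close> can fail to be surjective, its image contains all roots of
  \<open>D2\<close>, and these determine a Weyl group element.\<close>

lemma weyl_unique:
  assumes "v \<in> weyl D2" "v' \<in> weyl D2" "v \<circ> f = v' \<circ> f"
  shows "v = v'"
proof (rule R2.weyl_eqI[OF assms(1,2)])
  fix \<beta> assume "\<beta> \<in> roots D2"
  then obtain \<alpha> where "\<beta> = f \<alpha>" using f_roots by blast
  with assms(3) show "v \<beta> = v' \<beta>" by (simp add: fun_eq_iff)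
qed

text \<open>Although \<open>f\<close> can have a kernel, it is injective on roots, and Weyl group
  elements map roots to roots.\<close>

lemma weyl_injective:
  assumes "w \<in> weyl D1" "w' \<in> weyl D1" "f \<circ> w = f \<circ> w'"
  shows "w = w'"
proof (rule R1.weyl_eqI[OF assms(1,2)])
  fix \<alpha> assume "\<alpha> \<in> roots D1"
  then show "w \<alpha> = w' \<alpha>"
    using assms inj_onD[OF inj_on_roots, of "w \<alpha>" "w' \<alpha>"]
    by (simp add: fun_eq_iff R1.weyl_root)
qed

lemma weyl_map_eqI:
  assumes "v \<in> weyl D2" "v \<circ> f = f \<circ> w"
  shows "weyl_map D2 f w = v"
  unfolding weyl_map_def
proof (rule the_equality)
  show "v' = v" if "v' \<in> weyl D2 \<and> v' \<circ> f = f \<circ> w" for v'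
    using that assms by (intro weyl_unique) auto
qed (use assms in blast)

lemma weyl_map:
  assumes "w \<in> weyl D1"
  shows "weyl_map D2 f w \<in> weyl D2" "weyl_map D2 f w \<circ> f = f \<circ> w"
proof -
  obtain v where v: "v \<in> weyl D2" "v \<circ> f = f \<circ> w" using weyl_exists[OF assms] by blast
  with weyl_map_eqI[OF v] show "weyl_map D2 f w \<in> weyl D2" "weyl_map D2 f w \<circ> f = f \<circ> w"
    by simp_all
qed

lemma weyl_map_id: "weyl_map D2 f id = id"
  by (rule weyl_map_eqI) (simp_all add: weyl.intros(1))

lemma weyl_map_inv:
  assumes w: "w \<in> weyl D1"
  shows "weyl_map D2 f (inv w) = inv (weyl_map D2 f w)"
proof (rule weyl_map_eqI)
  let ?v = "weyl_map D2 f w"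
  show "inv ?v \<in> weyl D2" using weyl_map[OF w] R2.inv_weyl by blast
  have bij: "bij w" "bij ?v"
    using R1.bij_weyl[OF w] R2.bij_weyl weyl_map[OF w] by blast+
  show "inv ?v \<circ> f = f \<circ> inv w"
  proof
    fix x
    have "?v (f (inv w x)) = f (w (inv w x))"
      using weyl_map(2)[OF w] by (metis comp_apply)
    also have "w (inv w x) = x"
      using bij(1) by (simp add: bij_is_surj surj_f_inv_f)
    finally show "(inv ?v \<circ> f) x = (f \<circ> inv w) x"
      using bij(2) by (metis comp_apply bij_inv_eq_iff)
  qed
qed

text \<open>Each root of \<open>D2\<close> lifts to a root of \<open>D1\<close>, so a product of
  reflections lifts factor by factor.\<close>

lemma weyl_map_surj: "v \<in> weyl D2 \<Longrightarrow> \<exists>w\<in>weyl D1. v \<circ> f = f \<circ> w"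
proof (induction rule: weyl.induct)
  case weyl_id
  show ?case by (rule bexI[of _ id]) (simp_all add: weyl.intros(1))
next
  case (weyl_reflection v \<beta>)
  then obtain w where w: "w \<in> weyl D1" "v \<circ> f = f \<circ> w" by blast
  obtain \<alpha> where \<alpha>: "\<alpha> \<in> roots D1" "\<beta> = f \<alpha>" using weyl_reflection.hyps f_roots by blast
  then have "reflection D1 \<alpha> \<circ> w \<in> weyl D1" using w weyl.intros(2) by blast
  moreover have "reflection D2 \<beta> \<circ> v \<circ> f = f \<circ> (reflection D1 \<alpha> \<circ> w)"
    using w(2) \<alpha> by (simp add: fun_eq_iff f_reflection)
  ultimately show ?case by blast
qed

section \<open>Lengths and longest elements under the identification\<close>

lemma word_prod_map:
  "set \<alpha>s \<subseteq> roots D1 \<Longrightarrow> word_prod D2 (map f \<alpha>s) \<circ> f = f \<circ> word_prod D1 \<alpha>s"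
  by (induction \<alpha>s) (simp_all add: word_prod_def fun_eq_iff f_reflection)

text \<open>One direction holds because intertwining with \<open>f\<close> characterizes
  \<open>weyl_map\<close>, the other because composition with \<open>f\<close> still separates
  elements of \<open>weyl D1\<close>.\<close>

lemma word_prod_iff:
  assumes "w \<in> weyl D1" "set \<alpha>s \<subseteq> roots D1"
  shows "word_prod D2 (map f \<alpha>s) = weyl_map D2 f w \<longleftrightarrow> word_prod D1 \<alpha>s = w"
proof
  have "set (map f \<alpha>s) \<subseteq> roots D2"
    using assms(2) f_roots by auto
  then have word: "word_prod D2 (map f \<alpha>s) \<in> weyl D2"
    by (rule R2.word_prod_weyl)
  assume "word_prod D1 \<alpha>s = w"
  then have "weyl_map D2 f w = word_prod D2 (map f \<alpha>s)"
    using word word_prod_map[OF assms(2)] by (intro weyl_map_eqI) simp_all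
  then show "word_prod D2 (map f \<alpha>s) = weyl_map D2 f w" by simp
next
  assume "word_prod D2 (map f \<alpha>s) = weyl_map D2 f w"
  then have "f \<circ> word_prod D1 \<alpha>s = f \<circ> w"
    using word_prod_map[OF assms(2)] weyl_map(2)[OF assms(1)] by simp
  then show "word_prod D1 \<alpha>s = w"
    by (rule weyl_injective[OF R1.word_prod_weyl[OF assms(2)] assms(1)])
qed

text \<open>Words in the simple roots of \<open>D2\<close> are exactly the \<open>f\<close>-images
  of words of the same length for \<open>D1\<close>; \<open>word_prod_iff\<close> matches the
  elements they express.\<close>

lemma weyl_length_map:
  assumes w: "w \<in> weyl D1"
  shows "weyl_length D2 (weyl_map D2 f w) = weyl_length D1 w"
proof -
  have "(\<exists>\<beta>s. set \<beta>s \<subseteq> simple_roots D2 \<and> length \<beta>s = n \<and> word_prod D2 \<beta>s = weyl_map D2 f w) \<longleftrightarrow>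
    (\<exists>\<alpha>s. set \<alpha>s \<subseteq> simple_roots D1 \<and> length \<alpha>s = n \<and> word_prod D1 \<alpha>s = w)" for n
  proof
    assume "\<exists>\<beta>s. set \<beta>s \<subseteq> simple_roots D2 \<and> length \<beta>s = n \<and> word_prod D2 \<beta>s = weyl_map D2 f w"
    then obtain \<beta>s where \<beta>s: "set \<beta>s \<subseteq> simple_roots D2" "length \<beta>s = n"
      "word_prod D2 \<beta>s = weyl_map D2 f w" by blast
    have "\<beta>s \<in> lists (f ` simple_roots D1)"
      using \<beta>s(1) f_simple_roots by (simp add: in_lists_conv_set subset_iff)
    then obtain \<alpha>s where \<alpha>s: "set \<alpha>s \<subseteq> simple_roots D1" "\<beta>s = map f \<alpha>s"
      unfolding lists_image by (auto simp: lists_eq_set)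
    with \<beta>s show "\<exists>\<alpha>s. set \<alpha>s \<subseteq> simple_roots D1 \<and> length \<alpha>s = n \<and> word_prod D1 \<alpha>s = w"
      using word_prod_iff[OF w, of \<alpha>s] R1.simple_roots_subset by auto
  next
    assume "\<exists>\<alpha>s. set \<alpha>s \<subseteq> simple_roots D1 \<and> length \<alpha>s = n \<and> word_prod D1 \<alpha>s = w"
    then obtain \<alpha>s where \<alpha>s: "set \<alpha>s \<subseteq> simple_roots D1" "length \<alpha>s = n" "word_prod D1 \<alpha>s = w"
      by blast
    then have "word_prod D2 (map f \<alpha>s) = weyl_map D2 f w"
      using word_prod_iff[OF w, of \<alpha>s] R1.simple_roots_subset by auto
    then show "\<exists>\<beta>s. set \<beta>s \<subseteq> simple_roots D2 \<and> length \<beta>s = n \<and> word_prod D2 \<beta>s = weyl_map D2 f w"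
      using \<alpha>s f_simple_roots by (intro exI[of _ "map f \<alpha>s"]) auto
  qed
  then show ?thesis by (simp only: weyl_length_def)
qed

text \<open>Every competitor in \<open>weyl D2\<close> is the image of an element of
  \<open>weyl D1\<close> of the same length.\<close>

lemma longest_element_map:
  assumes "longest_element D1 w0"
  shows "longest_element D2 (weyl_map D2 f w0)"
  unfolding longest_element_def
proof (intro conjI ballI)
  have w0: "w0 \<in> weyl D1" using assms by (simp add: longest_element_def)
  then show "weyl_map D2 f w0 \<in> weyl D2" by (rule weyl_map)
  fix v assume v: "v \<in> weyl D2"
  then obtain w where w: "w \<in> weyl D1" "v \<circ> f = f \<circ> w" using weyl_map_surj by blast
  then have "v = weyl_map D2 f w" using weyl_map_eqI[OF v] by simp
  then show "weyl_length D2 v \<le> weyl_length D2 (weyl_map D2 f w0)"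
    using assms w w0 by (simp add: weyl_length_map longest_element_def)
qed

end

section \<open>The star operation\<close>

lemma ring_inverse_eqI:
  assumes "a * b = 1" "b * a = 1"
  shows "ring_inverse a = b"
  unfolding ring_inverse_def
proof (rule the_equality)
  show "b' = b" if "a * b' = 1 \<and> b' * a = 1" for b'
    using that assms by (metis mult.assoc mult_1_left mult_1_right)
qed (use assms in blast)

section \<open>Normalizations and star operation of a single Hecke algebra\<close>

locale affine_hecke =
  fixes D :: "('x::ab_group_add, 'y::ab_group_add) root_datum"
    and q :: real and l ls :: "'x \<Rightarrow> real"
    and A :: "('x, 'h::ring_1) hecke_data" and st :: "'h \<Rightarrow> 'h"
  assumes hecke: "affine_hecke_algebra D q l ls A"
    and star: "hecke_star D A st"
begin

sublocale based_root_datum D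
  using hecke unfolding affine_hecke_algebra_def by unfold_locales blast

sublocale V: vector_space "smul A"
  using hecke unfolding affine_hecke_algebra_def complex_algebra_def by blast

lemma smul_mult: "smul A c (a * b) = smul A c a * b" "smul A c (a * b) = a * smul A c b"
  using hecke unfolding affine_hecke_algebra_def complex_algebra_def by blast+

lemma theta_mult: "theta A x * theta A y = theta A (x + y)"
  using hecke unfolding affine_hecke_algebra_def by blast

lemma TT_mult_id: "w \<in> weyl D \<Longrightarrow> TT A w * TT A id = TT A w"
proof -
  have "\<forall>w\<in>weyl D. \<forall>w'\<in>weyl D. weyl_length D (w \<circ> w') = weyl_length D w + weyl_length D w' \<longrightarrow>
      TT A w * TT A w' = TT A (w \<circ> w')"
    using hecke unfolding affine_hecke_algebra_def by blast
  then show "w \<in> weyl D \<Longrightarrow> TT A w * TT A id = TT A w"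
    using weyl.intros(1)[of D] weyl_length_id by (metis add_0_right comp_id)
qed

text \<open>The spanning half of the basis property, in a form suited to identities that are
  additive in \<open>h\<close>.\<close>

lemma hecke_basis_induct:
  assumes "P 0"
    and "\<And>c x w h. w \<in> weyl D \<Longrightarrow> P h \<Longrightarrow> P (smul A c (theta A x * TT A w) + h)"
  shows "P h"
proof -
  have "V.span ((\<lambda>(x, w). theta A x * TT A w) ` (UNIV \<times> weyl D)) = UNIV"
    using hecke unfolding affine_hecke_algebra_def Let_def by blast
  then have "h \<in> V.span ((\<lambda>(x, w). theta A x * TT A w) ` (UNIV \<times> weyl D))" by simp
  then show ?thesis
    by (induction rule: V.span_induct_alt) (use assms in auto)
qed

text \<open>Since \<open>theta A 0\<close> is absorbed by the leftmost factor of each basis element,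
  it is a left unit; evaluate at 1.\<close>

lemma theta_0: "theta A 0 = 1"
proof -
  have "theta A 0 * h = h" for h
  proof (induction h rule: hecke_basis_induct)
    case (2 c x w h)
    have "theta A 0 * smul A c (theta A x * TT A w) = smul A c (theta A 0 * theta A x * TT A w)"
      by (simp only: smul_mult(2) mult.assoc)
    with 2 show ?case by (simp add: distrib_left theta_mult)
  qed simp
  from this[of 1] show ?thesis by simp
qed

text \<open>Here the rightmost factor of each basis element absorbs \<open>TT A id\<close>, giving a
  right unit.\<close>

lemma TT_id: "TT A id = 1"
proof -
  have "h * TT A id = h" for h
  proof (induction h rule: hecke_basis_induct)
    case (2 c x w h)
    have "smul A c (theta A x * TT A w) * TT A id = smul A c (theta A x * (TT A w * TT A id))"
      by (simp only: smul_mult(1) mult.assoc)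
    with 2 show ?case by (simp only: distrib_right TT_mult_id)
  qed simp
  from this[of 1] show ?thesis by simp
qed

lemma star_add: "st (a + b) = st a + st b"
  and star_smul: "st (smul A c a) = smul A (cnj c) (st a)"
  and star_mult: "st (a * b) = st b * st a"
  and star_TT: "w \<in> weyl D \<Longrightarrow> st (TT A w) = TT A (inv w)"
  and star_theta: "longest_element D w0 \<Longrightarrow>
    st (theta A x) = TT A w0 * theta A (- w0 x) * ring_inverse (TT A w0)"
  using star unfolding hecke_star_def by blast+

text \<open>Surjectivity gives \<open>st e = 1\<close>; applying \<open>st\<close> to
  \<open>e * 1\<close> then yields \<open>st 1 * 1 = 1\<close>.\<close>

lemma star_1: "st 1 = 1"
proof -
  obtain e where "st e = 1" using star by (metis hecke_star_def bij_pointE)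
  then show ?thesis using star_mult[of e 1] by simp
qed

text \<open>Applying the star operation to \<open>\<theta>\<^sub>0 = 1\<close> yields a right inverse of \<open>T\<^bsub>w\<^esub>\<close> for every longest
  \<open>w\<close>; the starred equation for \<open>w\<^sup>-\<^sup>1\<close> yields a left inverse.\<close>

lemma TT_longest_inverse:
  assumes w0: "longest_element D w0"
  shows "TT A w0 * ring_inverse (TT A w0) = 1" "ring_inverse (TT A w0) * TT A w0 = 1"
proof -
  have weyl: "w0 \<in> weyl D" using w0 by (simp add: longest_element_def)
  have right: "TT A w * ring_inverse (TT A w) = 1" if w: "longest_element D w" for w
  proof -
    have "additive w" using w by (simp add: longest_element_def additive_weyl)
    then show ?thesis
      using star_theta[OF w, of 0] by (simp add: additive.zero theta_0 star_1)
  qed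
  let ?r = "st (ring_inverse (TT A (inv w0)))"
  have "st (TT A (inv w0)) = TT A w0"
    using star_TT[OF inv_weyl[OF weyl]] inv_inv_eq[OF bij_weyl[OF weyl]] by simp
  then have left: "?r * TT A w0 = 1"
    using arg_cong[OF right[OF longest_element_inv[OF w0]], of st] by (simp add: star_mult star_1)
  show "TT A w0 * ring_inverse (TT A w0) = 1" by (rule right[OF w0])
  with left have "?r = ring_inverse (TT A w0)"
    by (metis mult.assoc mult_1_left mult_1_right)
  with left show "ring_inverse (TT A w0) * TT A w0 = 1" by simp
qed

end

section \<open>Compatibility of a central morphism with the star operations\<close>

locale central_hecke = central_morphism D1 D2 f + H1: affine_hecke D1 q l1 ls1 A1 st1 +
  H2: affine_hecke D2 q l2 ls2 A2 st2
  for D1 :: "('x1::ab_group_add, 'y1::ab_group_add) root_datum"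
    and D2 :: "('x2::ab_group_add, 'y2::ab_group_add) root_datum"
    and f q l1 ls1 l2 ls2
    and A1 :: "('x1, 'h1::ring_1) hecke_data" and A2 :: "('x2, 'h2::ring_1) hecke_data"
    and st1 st2 +
  fixes \<phi> :: "'h1 \<Rightarrow> 'h2"
  assumes hom: "algebra_hom A1 A2 \<phi>"
    and hom_basis: "w \<in> weyl D1 \<Longrightarrow>
      \<phi> (theta A1 x * TT A1 w) = theta A2 (f x) * TT A2 (weyl_map D2 f w)"
begin

lemma hom_add: "\<phi> (a + b) = \<phi> a + \<phi> b"
  and hom_smul: "\<phi> (smul A1 c a) = smul A2 c (\<phi> a)"
proof -
  have "module_hom (smul A1) (smul A2) \<phi>"
    using hom by (simp add: algebra_hom_def Vector_Spaces.linear.axioms)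
  then show "\<phi> (a + b) = \<phi> a + \<phi> b" "\<phi> (smul A1 c a) = smul A2 c (\<phi> a)"
    by (simp_all add: module_hom.add module_hom.scale)
qed

lemma hom_1: "\<phi> 1 = 1" and hom_mult: "\<phi> (a * b) = \<phi> a * \<phi> b"
  using hom by (simp_all add: algebra_hom_def)

lemma hom_theta: "\<phi> (theta A1 x) = theta A2 (f x)"
  using hom_basis[OF weyl.intros(1), of x] by (simp add: H1.TT_id H2.TT_id weyl_map_id)

lemma hom_TT: "w \<in> weyl D1 \<Longrightarrow> \<phi> (TT A1 w) = TT A2 (weyl_map D2 f w)"
  using hom_basis[of w 0] by (simp add: H1.theta_0 H2.theta_0 additive.zero[OF additive_f])

lemma hom_star_TT: "w \<in> weyl D1 \<Longrightarrow> \<phi> (st1 (TT A1 w)) = st2 (\<phi> (TT A1 w))"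
  by (simp add: H1.star_TT H2.star_TT hom_TT weyl_map weyl_map_inv R1.inv_weyl)

lemma hom_star_theta: "\<phi> (st1 (theta A1 x)) = st2 (\<phi> (theta A1 x))"
proof -
  obtain w0 where w0: "longest_element D1 w0" using R1.longest_element_exists by blast
  then have weyl: "w0 \<in> weyl D1" by (simp add: longest_element_def)
  let ?v = "weyl_map D2 f w0"
  \<comment> \<open>A unital homomorphism preserves two-sided inverses, which evaluates the definite
    description on the target side.\<close>
  have "ring_inverse (TT A2 ?v) = \<phi> (ring_inverse (TT A1 w0))"
    using H1.TT_longest_inverse[OF w0]
    by (intro ring_inverse_eqI) (simp_all add: hom_mult[symmetric] hom_TT[OF weyl, symmetric] hom_1)
  moreover have "f (- w0 x) = - ?v (f x)"
    using weyl_map(2)[OF weyl] by (simp add: fun_eq_iff additive.minus[OF additive_f])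
  ultimately show ?thesis
    using H1.star_theta[OF w0, of x] H2.star_theta[OF longest_element_map[OF w0], of "f x"]
    by (simp add: hom_mult hom_theta hom_TT weyl)
qed

text \<open>Both sides are conjugate-linear and reverse products, so the basis reduces to its
  factors \<open>theta\<close> and \<open>TT\<close>.\<close>

lemma hom_star: "\<phi> (st1 h) = st2 (\<phi> h)"
proof (induction h rule: H1.hecke_basis_induct)
  case 1
  have "st1 0 = 0" "st2 0 = 0" "\<phi> 0 = 0"
    using H1.star_add[of 0 0] H2.star_add[of 0 0] hom_add[of 0 0] by simp_all
  then show ?case by simp
next
  case (2 c x w h)
  then show ?case
    by (simp add: hom_add hom_smul hom_mult H1.star_add H2.star_add H1.star_smul H2.star_smul
        H1.star_mult H2.star_mult hom_star_TT hom_star_theta)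
qed

end

section \<open>Complete reducibility of unitary modules\<close>

text \<open>A basis of \<open>U\<close> together with a vector of \<open>V\<close> outside
  \<open>U\<close> is independent inside the span of a basis of \<open>V\<close>.\<close>

lemma (in vector_space) dim_strict_mono:
  assumes "subspace U" "U \<subset> V" "finite T" "V \<subseteq> span T"
  shows "dim U < dim V"
proof -
  obtain b where b: "b \<subseteq> U" "independent b" "U \<subseteq> span b" "card b = dim U"
    using basis_exists by blast
  obtain c where c: "c \<subseteq> V" "independent c" "V \<subseteq> span c" "card c = dim V"
    using basis_exists by blast
  obtain v where v: "v \<in> V" "v \<notin> U" using assms(2) by blast
  have "v \<notin> span b"
    using v(2) span_minimal[OF b(1) assms(1)] by blast
  then have "independent (insert v b)"
    using b(2) by (rule independent_insertI)
  moreover have "insert v b \<subseteq> span c"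
    using v(1) b(1) c(3) assms(2) by blast
  \<comment> \<open>The ambient space can be infinite-dimensional; finiteness of \<open>c\<close>
    comes from independence inside the span of \<open>T\<close>.\<close>
  moreover have "finite c"
    using independent_span_bound[OF assms(3) c(2)] c(1) assms(4) by blast
  ultimately have card: "finite (insert v b) \<and> card (insert v b) \<le> card c"
    by (intro independent_span_bound)
  then have "finite b" by simp
  moreover have "v \<notin> b" using v(2) b(1) by blast
  ultimately have "card (insert v b) = Suc (card b)" by simp_all
  with card show ?thesis using b(4) c(4) by linarith
qed

section \<open>Invariant inner products and orthogonality\<close>

locale unitary_hecke_module =
  fixes A :: "('x, 'h::ring_1) hecke_data" and M :: "('h, 'v::ab_group_add) hmodule"
    and st :: "'h \<Rightarrow> 'h" and B :: "'v \<Rightarrow> 'v \<Rightarrow> complex"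
  assumes hecke_module: "hecke_module A M"
    and form: "hermitian_form M B"
    and pos: "\<And>v. v \<in> carrier M \<Longrightarrow> v \<noteq> 0 \<Longrightarrow> 0 < Re (B v v)"
    and invariant: "star_invariant st M B"
begin

sublocale V: vector_space "scal M"
  by (rule hecke_module[unfolded hecke_module_def, THEN conjunct1])

lemma subspace_carrier: "V.subspace (carrier M)"
  by (rule hecke_module[unfolded hecke_module_def, THEN conjunct2, THEN conjunct1])

lemmas carrier_closed =
  V.subspace_0[OF subspace_carrier] V.subspace_add[OF subspace_carrier]
  V.subspace_diff[OF subspace_carrier] V.subspace_scale[OF subspace_carrier]
  V.subspace_sum[OF subspace_carrier]

lemma form_commute: "v \<in> carrier M \<Longrightarrow> w \<in> carrier M \<Longrightarrow> B w v = cnj (B v w)"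
  using form unfolding hermitian_form_def by blast

lemma form_add: "u \<in> carrier M \<Longrightarrow> v \<in> carrier M \<Longrightarrow> w \<in> carrier M \<Longrightarrow> B (u + v) w = B u w + B v w"
  and form_scale: "v \<in> carrier M \<Longrightarrow> w \<in> carrier M \<Longrightarrow> B (scal M c v) w = c * B v w"
  using form unfolding hermitian_form_def by blast+

lemma form_0: "w \<in> carrier M \<Longrightarrow> B 0 w = 0" "w \<in> carrier M \<Longrightarrow> B w 0 = 0"
proof -
  show "B 0 w = 0" if "w \<in> carrier M" for w
    using form_scale[OF that that, of 0] by simp
  then show "B w 0 = 0" if "w \<in> carrier M"
    using form_commute[of 0 w] carrier_closed(1) that by simp
qed

lemma form_diff:
  assumes "u \<in> carrier M" "v \<in> carrier M" "w \<in> carrier M"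
  shows "B (u - v) w = B u w - B v w"
  using form_add[of "u - v" v w] assms carrier_closed by simp

lemma form_sum:
  assumes "\<And>i. i \<in> I \<Longrightarrow> f i \<in> carrier M" "w \<in> carrier M"
  shows "B (\<Sum>i\<in>I. f i) w = (\<Sum>i\<in>I. B (f i) w)"
  using assms(1)
  by (induction I rule: infinite_finite_induct)
    (simp_all add: form_0 form_add carrier_closed assms(2))

lemma subspace_orthogonal:
  assumes "V.subspace N" "N \<subseteq> carrier M" "S \<subseteq> carrier M"
  shows "V.subspace {v \<in> N. \<forall>s\<in>S. B v s = 0}"
  using assms by (auto simp: V.subspace_def form_0 form_add form_scale subset_iff)

text \<open>Linearity is available in the first argument only, so symmetry moves the spanning
  vectors there; those orthogonal to \<open>u\<close> form a subspace containing
  \<open>T\<close>.\<close>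

lemma orthogonal_span:
  assumes "u \<in> carrier M" "T \<subseteq> carrier M" "\<And>t. t \<in> T \<Longrightarrow> B u t = 0" "t \<in> V.span T"
  shows "B u t = 0"
proof -
  have "T \<subseteq> {v \<in> carrier M. \<forall>s\<in>{u}. B v s = 0}"
    using assms(1-3) form_commute[OF assms(1)] by auto
  moreover have "V.subspace {v \<in> carrier M. \<forall>s\<in>{u}. B v s = 0}"
    using assms(1) by (intro subspace_orthogonal subspace_carrier) auto
  ultimately have "t \<in> {v \<in> carrier M. \<forall>s\<in>{u}. B v s = 0}"
    using V.span_minimal assms(4) by blast
  then show ?thesis using form_commute[of t u] assms(1) by simp
qed

text \<open>Gram-Schmidt on the generating set. Keeping \<open>v\<close> arbitrary lets the
  induction hypothesis project both the new generator \<open>a\<close> and the given vector.\<close>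

lemma orthogonal_projection:
  assumes "finite T" "T \<subseteq> carrier M" "v \<in> carrier M"
  shows "\<exists>p\<in>V.span T. \<forall>t\<in>V.span T. B (v - p) t = 0"
  using assms
proof (induction arbitrary: v rule: finite_induct)
  case empty
  then show ?case by (auto simp: form_0)
next
  case (insert a T)
  have T: "T \<subseteq> carrier M" "a \<in> carrier M" and span: "V.span T \<subseteq> carrier M"
    using insert.prems V.span_minimal[OF _ subspace_carrier] by auto
  obtain r where r: "r \<in> V.span T" "\<And>t. t \<in> V.span T \<Longrightarrow> B (a - r) t = 0"
    using insert.IH[OF T] by blast
  obtain p where p: "p \<in> V.span T" "\<And>t. t \<in> V.span T \<Longrightarrow> B (v - p) t = 0"
    using insert.IH[OF T(1) insert.prems(2)] by blast
  define a' where "a' = a - r"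
  \<comment> \<open>The Gram-Schmidt coefficient along \<open>a'\<close>, the part of
    \<open>a\<close> orthogonal to the old span. If \<open>a' = 0\<close>, division by zero gives
    \<open>c = 0\<close>, and the correction vanishes anyway.\<close>
  define c where "c = B v a' / B a' a'"
  let ?p = "p + scal M c a'"
  have "r \<in> carrier M" "p \<in> carrier M" "v \<in> carrier M"
    using r(1) p(1) span insert.prems by blast+
  moreover from this have "a' \<in> carrier M" "v - p \<in> carrier M"
    unfolding a'_def using T(2) by (simp_all add: carrier_closed(3))
  ultimately have in_carrier: "r \<in> carrier M" "p \<in> carrier M" "a' \<in> carrier M" "v - p \<in> carrier M"
    "scal M c a' \<in> carrier M" "v - ?p \<in> carrier M" "v \<in> carrier M"
    by (simp_all add: carrier_closed)
  have diff: "B (v - ?p) t = B (v - p) t - c * B a' t" if "t \<in> carrier M" for t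
    using form_diff[of "v - p" "scal M c a'" t] form_scale[of a' t c] in_carrier that
    by (simp add: diff_diff_eq)
  have ort: "B (v - ?p) t = 0" if "t \<in> V.span T" for t
    using diff[of t] p(2) r(2) span that by (auto simp: a'_def)
  have "B (v - ?p) a' = 0"
  proof (cases "a' = 0")
    case False
    then have "B a' a' \<noteq> 0" using pos in_carrier(3) by force
    moreover have "B p a' = 0"
      using form_commute[of a' p] r(2)[OF p(1)] in_carrier by (simp add: a'_def)
    ultimately show ?thesis
      using diff in_carrier by (simp add: c_def form_diff)
  qed (use form_0(2) in_carrier in blast)
  \<comment> \<open>Orthogonality to \<open>a\<close> is recovered from \<open>a = a' + r\<close>,
    after moving both parts into the additive first argument.\<close>
  then have "B a' (v - ?p) = 0" "B r (v - ?p) = 0"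
    using ort[OF r(1)] form_commute[of "v - ?p" a'] form_commute[of "v - ?p" r] in_carrier
    by simp_all
  then have "B a (v - ?p) = 0"
    using form_add[of a' r "v - ?p"] in_carrier by (simp add: a'_def)
  then have "B (v - ?p) a = 0"
    using form_commute[of a "v - ?p"] in_carrier T by simp
  then have gen: "B (v - ?p) t = 0" if "t \<in> insert a T" for t
    using ort V.span_base that by blast
  have "B (v - ?p) t = 0" if "t \<in> V.span (insert a T)" for t
    by (rule orthogonal_span[OF in_carrier(6) _ gen that]) (use T in blast)
  moreover have "?p \<in> V.span (insert a T)"
    using r(1) p(1) V.span_mono[of T "insert a T"] V.span_base[of a "insert a T"]
    unfolding a'_def by (intro V.span_add V.span_scale V.span_diff) auto
  ultimately show ?case by blast
qed

text \<open>Invariance moves the action of \<open>h\<close> to that of \<open>st h\<close> on the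
  other argument, which remains in \<open>S\<close>.\<close>

lemma submodule_orthogonal:
  assumes N: "is_submodule M N" and S: "is_submodule M S"
  shows "is_submodule M {v \<in> N. \<forall>s\<in>S. B v s = 0}"
proof -
  have "B (act M h v) s = 0" if "v \<in> N" "\<forall>s\<in>S. B v s = 0" "s \<in> S" for h v s
  proof -
    have "B (act M h v) s = B v (act M (st h) s)"
      using invariant that N S unfolding star_invariant_def is_submodule_def by blast
    then show ?thesis using that S by (auto simp: is_submodule_def)
  qed
  then show ?thesis
    using N S subspace_orthogonal[of N S] by (auto simp: is_submodule_def)
qed

text \<open>Simplicity is phrased inside \<open>M\<close>, so that the induction below never changes
  the carrier; \<open>simple_decomposition\<close> passes to \<open>simple_module\<close>.\<close>

definition simple_submodule :: "'v set \<Rightarrow> bool" where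
  "simple_submodule S \<longleftrightarrow> is_submodule M S \<and> S \<noteq> {0} \<and>
    (\<forall>K. is_submodule M K \<and> K \<subseteq> S \<longrightarrow> K = {0} \<or> K = S)"

text \<open>Induction on the dimension of \<open>N\<close>: a nonzero submodule of least dimension
  is split off, and its orthogonal complement within \<open>N\<close> has smaller dimension.\<close>

lemma orthogonal_decomposition:
  assumes T: "finite T" "carrier M \<subseteq> V.span T" and "is_submodule M N"
  shows "\<exists>(n::nat) F. (\<forall>i<n. simple_submodule (F i) \<and> F i \<subseteq> N) \<and>
    (\<forall>i<n. \<forall>j<n. i \<noteq> j \<longrightarrow> (\<forall>u\<in>F i. \<forall>v\<in>F j. B u v = 0)) \<and>
    (\<forall>v\<in>N. \<exists>s. (\<forall>i<n. s i \<in> F i) \<and> v = (\<Sum>i<n. s i))"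
  using assms(3)
proof (induction N rule: measure_induct_rule[of V.dim])
  case (less N)
  show ?case
  proof (cases "N = {0}")
    case True
    then show ?thesis by (intro exI[of _ "0::nat"]) simp
  next
    case False
    let ?P = "\<lambda>S. is_submodule M S \<and> S \<subseteq> N \<and> S \<noteq> {0}"
    obtain S where S: "is_submodule M S" "S \<subseteq> N" "S \<noteq> {0}"
      and least: "\<And>K. ?P K \<Longrightarrow> V.dim S \<le> V.dim K"
      using ex_has_least_nat[of ?P N V.dim] less.prems False by blast
    have carrier: "S \<subseteq> carrier M" "N \<subseteq> carrier M" and sub: "V.subspace S" "V.subspace N"
      using S(1) less.prems by (auto simp: is_submodule_def)
    have "K = {0} \<or> K = S" if "is_submodule M K" "K \<subseteq> S" for K
    \<comment> \<open>A nonzero proper submodule of \<open>S\<close> would have strictly smaller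
      dimension, against the choice of \<open>S\<close>.\<close>
    proof (rule ccontr)
      assume "\<not> ?thesis"
      then have "V.dim K < V.dim S" "?P K"
        using that S(2) V.dim_strict_mono[of K S T] T carrier by (auto simp: is_submodule_def)
      with least show False by fastforce
    qed
    then have simple: "simple_submodule S"
      using S by (simp add: simple_submodule_def)
    let ?N = "{v \<in> N. \<forall>s\<in>S. B v s = 0}"
    have N': "is_submodule M ?N"
      by (rule submodule_orthogonal[OF less.prems S(1)])
    obtain s where s: "s \<in> S" "s \<noteq> 0"
      using S(3) V.subspace_0[OF sub(1)] by blast
    \<comment> \<open>By positivity \<open>s\<close> is not orthogonal to itself, so it witnesses
      that the complement is proper.\<close>
    then have "B s s \<noteq> 0" using pos[of s] carrier by force
    then have "?N \<subset> N" using s S(2) by blast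
    then have "V.dim ?N < V.dim N"
      using V.dim_strict_mono[of ?N N T] N' T carrier by (auto simp: is_submodule_def)
    from less.IH[OF this N'] obtain n :: nat and F where IH:
      "\<forall>i<n. simple_submodule (F i) \<and> F i \<subseteq> ?N"
      "\<forall>i<n. \<forall>j<n. i \<noteq> j \<longrightarrow> (\<forall>u\<in>F i. \<forall>v\<in>F j. B u v = 0)"
      "\<forall>v\<in>?N. \<exists>s. (\<forall>i<n. s i \<in> F i) \<and> v = (\<Sum>i<n. s i)"
      by (elim exE conjE) (rule that)
    have F: "simple_submodule (F i) \<and> F i \<subseteq> ?N" if "i < n" for i
      using IH(1) that by simp
    have ort: "B u v = 0" if "i < n" "j < n" "i \<noteq> j" "u \<in> F i" "v \<in> F j" for i j u v
      using IH(2) that by metis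
    have gen: "\<exists>s. (\<forall>i<n. s i \<in> F i) \<and> v = (\<Sum>i<n. s i)" if "v \<in> ?N" for v
      by (rule bspec[OF IH(3) that])
    have ort_S: "B u v = 0" "B v u = 0" if "i < n" "u \<in> F i" "v \<in> S" for i u v
    proof -
      have "u \<in> ?N" using F that by blast
      with that(3) carrier form_commute[of u v] show "B u v = 0" "B v u = 0" by auto
    qed
    \<comment> \<open>The new summand takes the index \<open>n\<close>, leaving the summands of the
      complement at the indices below \<open>n\<close>.\<close>
    let ?F = "F(n := S)"
    have gen': "\<exists>s. (\<forall>i<Suc n. s i \<in> ?F i) \<and> v = (\<Sum>i<Suc n. s i)" if v: "v \<in> N" for v
    proof -
      \<comment> \<open>Projection onto \<open>S\<close> requires a finite spanning set. With the
        projection \<open>p\<close>, the remainder \<open>v - p\<close> lies in the complement and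
        is decomposed by the induction hypothesis.\<close>
      obtain b where b: "b \<subseteq> S" "V.independent b" "S \<subseteq> V.span b" "card b = V.dim S"
        by (rule V.basis_exists)
      have span: "V.span b = S" using b V.span_minimal[OF b(1) sub(1)] by blast
      have "finite b"
        using V.independent_span_bound[OF T(1) b(2)] b(1) T(2) carrier by blast
      then obtain p where p: "p \<in> S" "\<forall>t\<in>S. B (v - p) t = 0"
        using orthogonal_projection[of b v] b(1) v carrier unfolding span by blast
      then have "v - p \<in> ?N"
        using v S(2) V.subspace_diff[OF sub(2)] by blast
      then obtain s where "\<forall>i<n. s i \<in> F i" "v - p = (\<Sum>i<n. s i)"
        using gen by blast
      then show ?thesis
        using p by (intro exI[of _ "s(n := p)"]) (auto simp: less_Suc_eq algebra_simps)
    qed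
    have "simple_submodule (?F i)" "?F i \<subseteq> N" if "i < Suc n" for i
      using that F[of i] S simple by (cases "i = n"; auto)+
    moreover have "B u v = 0"
      if "i < Suc n" "j < Suc n" "i \<noteq> j" "u \<in> ?F i" "v \<in> ?F j" for i j u v
      using that ort ort_S by (auto simp: less_Suc_eq split: if_splits)
    ultimately show ?thesis
      using gen' by (intro exI[of _ "Suc n"] exI[of _ ?F] conjI allI ballI impI)
  qed
qed

lemma unitary_submodule:
  assumes "N \<subseteq> carrier M"
  shows "unitary st (M\<lparr>carrier := N\<rparr>)"
  unfolding unitary_def
proof (intro exI[of _ B] conjI)
  have N: "carrier (M\<lparr>carrier := N\<rparr>) = N" "scal (M\<lparr>carrier := N\<rparr>) = scal M"
    "act (M\<lparr>carrier := N\<rparr>) = act M"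
    by simp_all
  show "hermitian_form (M\<lparr>carrier := N\<rparr>) B"
    using form assms unfolding hermitian_form_def N by blast
  show "star_invariant st (M\<lparr>carrier := N\<rparr>) B"
    using invariant assms unfolding star_invariant_def N by blast
  show "\<forall>v\<in>carrier (M\<lparr>carrier := N\<rparr>). v \<noteq> 0 \<longrightarrow> 0 < Re (B v v)"
    using pos assms by auto
qed

text \<open>For uniqueness, pair the vanishing total difference of two decompositions with its
  \<open>i\<close>-th component: orthogonality leaves only the \<open>i\<close>-th term, and
  positivity makes it zero.\<close>

lemma internal_direct_sum_orthogonal:
  fixes n :: nat
  assumes F: "\<And>i. i < n \<Longrightarrow> is_submodule M (F i)"
    and ort: "\<And>i j u v. i < n \<Longrightarrow> j < n \<Longrightarrow> i \<noteq> j \<Longrightarrow> u \<in> F i \<Longrightarrow> v \<in> F j \<Longrightarrow> B u v = 0"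
    and gen: "\<And>v. v \<in> carrier M \<Longrightarrow> \<exists>s. (\<forall>i<n. s i \<in> F i) \<and> v = (\<Sum>i<n. s i)"
  shows "internal_direct_sum M {..<n} F"
  unfolding internal_direct_sum_def
proof (intro conjI ballI)
  fix v assume "v \<in> carrier M"
  then obtain s where s: "\<forall>i<n. s i \<in> F i" "v = (\<Sum>i<n. s i)"
    using gen by blast
  show "\<exists>!s. s \<in> Pi\<^sub>E {..<n} F \<and> v = (\<Sum>i<n. s i)"
  proof (rule ex_ex1I)
    show "\<exists>s. s \<in> Pi\<^sub>E {..<n} F \<and> v = (\<Sum>i<n. s i)"
      \<comment> \<open>Restriction sets the values outside the index set to
        \<open>undefined\<close>, as membership in \<open>Pi\<^sub>E\<close> demands.\<close>
      using s by (intro exI[of _ "restrict s {..<n}"]) auto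
  next
    fix s t
    assume s: "s \<in> Pi\<^sub>E {..<n} F \<and> v = (\<Sum>i<n. s i)" and t: "t \<in> Pi\<^sub>E {..<n} F \<and> v = (\<Sum>i<n. t i)"
    have d: "s i - t i \<in> F i" "F i \<subseteq> carrier M" if "i < n" for i
      using F[OF that] s t that V.subspace_diff by (auto simp: is_submodule_def PiE_def Pi_def)
    have "s i = t i" if "i < n" for i
    proof (rule ccontr)
      assume "s i \<noteq> t i"
      have "0 = B (\<Sum>j<n. s j - t j) (s i - t i)"
        using s t form_0(1)[of "s i - t i"] d[OF that] by (auto simp: sum_subtractf)
      also have "\<dots> = (\<Sum>j<n. B (s j - t j) (s i - t i))"
        using d that by (intro form_sum) auto
      also have "\<dots> = (\<Sum>j\<in>{i}. B (s j - t j) (s i - t i))"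
        using ort[OF _ that _ d(1) d(1)[OF that]] that by (intro sum.mono_neutral_right) auto
      finally have "Re (B (s i - t i) (s i - t i)) = 0" by simp
      moreover have "s i - t i \<in> carrier M" using d that by blast
      ultimately show False using pos[of "s i - t i"] \<open>s i \<noteq> t i\<close> by simp
    qed
    then show "s = t" using s t by (intro PiE_ext[of s "{..<n}" F t]) auto
  qed
qed (use F in auto)

lemma simple_decomposition:
  assumes "finite_dim M"
  shows "\<exists>(n::nat) N. internal_direct_sum M {..<n} N \<and>
    (\<forall>i<n. simple_module (M\<lparr>carrier := N i\<rparr>) \<and> unitary st (M\<lparr>carrier := N i\<rparr>))"
proof -
  obtain T where "finite T" "V.span T = carrier M"
    using assms by (auto simp: finite_dim_def)
  moreover have "is_submodule M (carrier M)"
    using hecke_module by (simp add: is_submodule_def hecke_module_def)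
  ultimately obtain n :: nat and F where
    F: "\<And>i. i < n \<Longrightarrow> simple_submodule (F i)"
    and ort: "\<And>i j u v. i < n \<Longrightarrow> j < n \<Longrightarrow> i \<noteq> j \<Longrightarrow> u \<in> F i \<Longrightarrow> v \<in> F j \<Longrightarrow> B u v = 0"
    and gen: "\<And>v. v \<in> carrier M \<Longrightarrow> \<exists>s. (\<forall>i<n. s i \<in> F i) \<and> v = (\<Sum>i<n. s i)"
    using orthogonal_decomposition[of T "carrier M"] by (metis order_refl)
  have "internal_direct_sum M {..<n} F"
    using F ort gen by (intro internal_direct_sum_orthogonal) (auto simp: simple_submodule_def)
  moreover have "unitary st (M\<lparr>carrier := F i\<rparr>)" if "i < n" for i
    using F[OF that] by (intro unitary_submodule) (simp add: simple_submodule_def is_submodule_def)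
  moreover have "simple_module (M\<lparr>carrier := F i\<rparr>)" if "i < n" for i
  proof -
    \<comment> \<open>Shrinking the carrier alters neither scalars nor action, so the two notions of
      simplicity agree.\<close>
    have "is_submodule M K \<and> K \<subseteq> F i" if "is_submodule (M\<lparr>carrier := F i\<rparr>) K" for K
      using that F[OF \<open>i < n\<close>] by (auto simp: simple_submodule_def is_submodule_def)
    with F[OF that] show ?thesis
      by (simp add: simple_submodule_def simple_module_def)
  qed
  ultimately show ?thesis by blast
qed

end

text \<open>Both records have the same functionals and scalars; the actions differ only by
  \<open>st2 (\<phi> h)\<close> against \<open>\<phi> (st1 h)\<close>. Hence this is an equality,
  not just an isomorphism.\<close>

lemma restrict_hermitian_dual:
  assumes "\<And>h. \<phi> (st1 h) = st2 (\<phi> h)"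
  shows "restrict_module \<phi> (hermitian_dual st2 V) = hermitian_dual st1 (restrict_module \<phi> V)"
  by (simp add: restrict_module_def hermitian_dual_def fun_eq_iff assms)

text \<open>The same form serves: invariance under \<open>h\<close> after restriction is invariance
  under \<open>\<phi> h\<close> before.\<close>

lemma unitary_restrict_module:
  assumes "\<And>h. \<phi> (st1 h) = st2 (\<phi> h)" and "unitary st2 V"
  shows "unitary st1 (restrict_module \<phi> V)"
proof -
  obtain B where B: "hermitian_form V B" "\<forall>v\<in>carrier V. v \<noteq> 0 \<longrightarrow> 0 < Re (B v v)"
    "star_invariant st2 V B"
    using assms(2) unfolding unitary_def by blast
  have "hermitian_form (restrict_module \<phi> V) B"
    using B(1) unfolding hermitian_form_def restrict_module_def hmodule.simps .
  moreover have "star_invariant st1 (restrict_module \<phi> V) B"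
    using B(3) unfolding star_invariant_def restrict_module_def hmodule.simps assms(1) by blast
  ultimately show ?thesis
    using B(2) unfolding unitary_def by (intro exI[of _ B]) (simp add: restrict_module_def)
qed

theorem proposition5p3:
  fixes D1 :: "('x1::ab_group_add, 'y1::ab_group_add) root_datum"
    and D2 :: "('x2::ab_group_add, 'y2::ab_group_add) root_datum"
    and q :: real
    and l1 ls1 :: "'x1 \<Rightarrow> real" and l2 ls2 :: "'x2 \<Rightarrow> real"
    and A1 :: "('x1, 'h1::ring_1) hecke_data" and A2 :: "('x2, 'h2::ring_1) hecke_data"
    and st1 :: "'h1 \<Rightarrow> 'h1" and st2 :: "'h2 \<Rightarrow> 'h2"
    and \<phi> :: "'h1 \<Rightarrow> 'h2"
    and V :: "('h2, 'v::ab_group_add) hmodule"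
  assumes "affine_hecke_algebra D1 q l1 ls1 A1" and "affine_hecke_algebra D2 q l2 ls2 A2"
    and "hecke_star D1 A1 st1" and "hecke_star D2 A2 st2"
    and "central_hecke_morphism D1 l1 ls1 A1 D2 l2 ls2 A2 \<phi>"
    and "hecke_module A2 V"
  shows "restrict_module \<phi> (hermitian_dual st2 V) = hermitian_dual st1 (restrict_module \<phi> V) \<and>
    (unitary st2 V \<longrightarrow> unitary st1 (restrict_module \<phi> V)) \<and>
    (unitary st2 V \<and> finite_dim V \<longrightarrow>
      (\<exists>(n::nat) N. internal_direct_sum (restrict_module \<phi> V) {..<n} N \<and>
        (\<forall>i<n. simple_module ((restrict_module \<phi> V)\<lparr>carrier := N i\<rparr>) \<and>
               unitary st1 ((restrict_module \<phi> V)\<lparr>carrier := N i\<rparr>))))"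
proof -
  obtain f where f: "central_root_morphism D1 D2 f" "algebra_hom A1 A2 \<phi>"
    "\<And>x w. w \<in> weyl D1 \<Longrightarrow> \<phi> (theta A1 x * TT A1 w) = theta A2 (f x) * TT A2 (weyl_map D2 f w)"
    using assms(5) unfolding central_hecke_morphism_def by blast
  interpret H1: affine_hecke D1 q l1 ls1 A1 st1 by unfold_locales fact+
  interpret H2: affine_hecke D2 q l2 ls2 A2 st2 by unfold_locales fact+
  interpret central_hecke D1 D2 f q l1 ls1 l2 ls2 A1 A2 st1 st2 \<phi>
    by unfold_locales (use f in auto)
  let ?M = "restrict_module \<phi> V"
  have unitary: "unitary st1 ?M" if "unitary st2 V"
    using hom_star that by (rule unitary_restrict_module)
  have "\<exists>(n::nat) N. internal_direct_sum ?M {..<n} N \<and>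
      (\<forall>i<n. simple_module (?M\<lparr>carrier := N i\<rparr>) \<and> unitary st1 (?M\<lparr>carrier := N i\<rparr>))"
    if V: "unitary st2 V" "finite_dim V"
  proof -
    \<comment> \<open>The decomposition is made over the first algebra, since a simple module over
      the second can become reducible on restriction.\<close>
    obtain B where B: "hermitian_form ?M B" "star_invariant st1 ?M B"
      "\<forall>v\<in>carrier ?M. v \<noteq> 0 \<longrightarrow> 0 < Re (B v v)"
      using unitary[OF V(1)] unfolding unitary_def by blast
    have "hecke_module A1 ?M"
      by (rule hecke_module_restrict_module[OF assms(6) f(2)])
    then interpret U: unitary_hecke_module A1 ?M st1 B
      by (rule unitary_hecke_module.intro) (use B in blast)+
    have "finite_dim ?M"
      using V(2) by (simp add: finite_dim_def restrict_module_def)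
    then show ?thesis by (rule U.simple_decomposition)
  qed
  with unitary restrict_hermitian_dual[of \<phi> st1 st2 V, OF hom_star] show ?thesis by blast
qed

end
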